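(* Let $u\ge 0$, $c>0$, $\lambda>0$. Let $T_0, T_1, T_2,\dots$ and $X_1,X_2,\dots$ be jointly independent random variables, where: the $T_j$ ($j\ge 0$) are positive; $T_0$ has density $f_0$ on $(0,\infty)$; the $T_j$, $j\ge 1$, are identically distributed with density $f$ on $(0,\infty)$; and the $X_j$, $j\ge1$, are identically distributed with $\mathbb{P}(X_j>x)=e^{-\lambda x}$ for $x\ge 0$. For $t\ge 0$ put $$N(t)=\inf\{j\ge 0:\ T_0+\cdots+T_j\ge t\},\qquad U(t)=u+ct-\sum_{1\le j\le N(t)}X_j,$$ and let $\tau=\inf\{t>0:\ U(t)<0\}$ be the ruin time. Then $\tau$ has a (defective) density $p_\tau$ on $(0,\infty)$ given by $$p_\tau(t)=e^{-\lambda(u+ct)}\left\{f_0(t)+\sum_{n=1}^\infty\frac{\lambda^n(u+ct)^{n-1}}{n!}\Bigl[u\,(f^{*n}*f_0)(t)+c\,(f^{*n}*f_1)(t)\Bigr]\right\},\qquad t>0,$$ where $f_1(t)=t f_0(t)$.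
   Context: For functions $g,h$ on $(0,\infty)$, the convolution is $(g*h)(t)=\int_0^t g(t-v)h(v)\,dv$; $g^{*1}=g$ and $g^{*n}=g^{*(n-1)}*g$ for $n\ge 2$. The infimum of the empty set is $+\infty$, so $\tau=\infty$ if ruin never occurs. That $\tau$ has a (defective) density $p_\tau$ means that $\mathbb{P}(\tau\le t)=\int_0^t p_\tau(r)\,dr$ for all $t>0$, where the total mass $\int_0^\infty p_\tau(r)\,dr=\mathbb{P}(\tau<\infty)$ may be less than $1$. In the model, $u$ is the initial surplus, $c$ the premium rate, $T_j$ the inter-claim times (the claim of size $X_1$ is made at time $T_0$, the claim of size $X_2$ at time $T_0+T_1$, etc.), and $X_j$ the claim sizes. *)

theory Defs
  imports "HOL-Probability.Probability"
begin

(* Convolution on (0,infinity). Only nonnegative functions are convolved, so the integral is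
   taken in [0,infinity]; values of g and h outside (0,infinity) are never used. *)
definition conv :: "(real \<Rightarrow> ennreal) \<Rightarrow> (real \<Rightarrow> ennreal) \<Rightarrow> real \<Rightarrow> ennreal" where
  "conv g h t = (\<integral>\<^sup>+v\<in>{0<..<t}. g (t - v) * h v \<partial>lborel)"

(* Meaningful for n \<ge> 1 only; the value at 0 is a dummy. *)
primrec conv_power :: "(real \<Rightarrow> ennreal) \<Rightarrow> nat \<Rightarrow> real \<Rightarrow> ennreal" where
  "conv_power g 0 = (\<lambda>_. 0)"
| "conv_power g (Suc n) = (if n = 0 then g else conv (conv_power g n) g)"

(* With \<ge> in place of >, this counts the claims made strictly before time t.
   The infimum is infinity if no partial sum reaches t. *)
definition claim_count :: "(nat \<Rightarrow> 'a \<Rightarrow> real) \<Rightarrow> real \<Rightarrow> 'a \<Rightarrow> enat" where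
  "claim_count T t \<omega> = (INF j\<in>{j. (\<Sum>i\<le>j. T i \<omega>) \<ge> t}. enat j)"

(* If the claim count is infinite, the sum below is 0 by the library convention for infinite
   index sets; for i.i.d. positive inter-claim times this happens with probability 0. *)
definition surplus ::
  "real \<Rightarrow> real \<Rightarrow> (nat \<Rightarrow> 'a \<Rightarrow> real) \<Rightarrow> (nat \<Rightarrow> 'a \<Rightarrow> real) \<Rightarrow> real \<Rightarrow> 'a \<Rightarrow> real" where
  "surplus u c T X t \<omega> = u + c * t - (\<Sum>j | 1 \<le> j \<and> enat j \<le> claim_count T t \<omega>. X j \<omega>)"

definition ruin_time ::
  "real \<Rightarrow> real \<Rightarrow> (nat \<Rightarrow> 'a \<Rightarrow> real) \<Rightarrow> (nat \<Rightarrow> 'a \<Rightarrow> real) \<Rightarrow> 'a \<Rightarrow> ereal" where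
  "ruin_time u c T X \<omega> = (INF t\<in>{t. 0 < t \<and> surplus u c T X t \<omega> < 0}. ereal t)"

(* The measurability clauses rule out the junk values that emeasure and the nonnegative integral
   take on non-measurable arguments. *)
definition has_defective_density :: "'a measure \<Rightarrow> ('a \<Rightarrow> ereal) \<Rightarrow> (real \<Rightarrow> ennreal) \<Rightarrow> bool" where
  "has_defective_density M \<tau> p \<longleftrightarrow>
     \<tau> \<in> borel_measurable M \<and>
     p \<in> borel_measurable (restrict_space lborel {0<..}) \<and>
     (\<forall>t>0. emeasure M {\<omega> \<in> space M. \<tau> \<omega> \<le> ereal t} = (\<integral>\<^sup>+r\<in>{0<..t}. p r \<partial>lborel))"

end

theory Submission
  imports Defs
begin

text \<open>
  Between claims the surplus increases, so ruin can only be caused by a claim. Write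
  \<open>S\<^sub>n = T\<^sub>0 + \<dots> + T\<^sub>n\<close>. If all gaps are positive, the ruin time is \<open>S\<^sub>n\<close> for the first \<open>n\<close> with
  \<open>u + c S\<^sub>n < X\<^sub>1 + \<dots> + X\<^sub>n\<^sub>+\<^sub>1\<close>, and it is infinite if there is no such \<open>n\<close>
  (\<open>ruin_time_le_iff\<close>). So \<open>P(\<tau> \<le> s)\<close> is the sum over \<open>n\<close> of the probabilities that this
  happens first at \<open>n\<close> and that \<open>S\<^sub>n \<le> s\<close>.

  Given \<open>T\<^sub>0 = t\<close>, the surplus just before the first claim is \<open>a = u + c t\<close>, and what follows is
  governed by the i.i.d. pairs \<open>(X\<^sub>i\<^sub>+\<^sub>1, T\<^sub>i\<^sub>+\<^sub>1)\<close>. The core is that for \<open>n \<ge> 1\<close> the law of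
  \<open>T\<^sub>1 + \<dots> + T\<^sub>n\<close>, restricted to the event that ruin first happens at \<open>S\<^sub>n\<close>, has the density
  \<open>exp (- \<lambda> (a + c r)) * \<lambda>^n * a * (a + c r)^(n - 1) / n! * f^{*n}(r)\<close>
  (\<open>ruin_functional_formula\<close>). This is proved by induction on \<open>n\<close>: a first claim \<open>x \<le> a\<close>
  followed by a gap \<open>t\<close> restarts the process with the surplus \<open>a - x + c t\<close>. Since the claims have
  no memory, the exponential factors combine into one that depends neither on \<open>x\<close> nor on \<open>t\<close>, and
  the induction step comes down to two identities.

  \<^item> \<open>s * f^{*(n+1)}(s) = (n + 1) * \<integral> t * f(t) * f^{*n}(s - t) dt\<close>, because multiplication by the
    argument is a derivation of the convolution (\<open>times_id_conv_power\<close>). By it the affine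
    weight \<open>a - x + c t\<close> may be replaced by \<open>a - x + c s / (n + 1)\<close> when \<open>t\<close> is integrated out.

  \<^item> \<open>(y + r)^(n - 1) * (y + r / (n + 1))\<close> is the derivative of
    \<open>y * (y + r)^n / (n + 1)\<close> in \<open>y\<close> (\<open>nn_integral_Abel_step\<close>). With \<open>y = a - x\<close> and \<open>r = c s\<close> this
    integrates out \<open>x\<close>.

  Finally \<open>T\<^sub>0 = t\<close> is integrated out. For ruin at time \<open>s\<close> the gaps after the first claim add up to
  \<open>r = s - t\<close>, so that \<open>a + c r = u + c s\<close> no longer depends on \<open>t\<close>, and the remaining factor
  \<open>a = u + c t\<close> yields the two convolutions with \<open>f\<^sub>0\<close> and with \<open>t f\<^sub>0(t)\<close>.
\<close>

section \<open>Convolution of functions vanishing on the negative half-line\<close>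

text \<open>
  For functions of this kind the integral over \<open>{0<..<t}\<close> defining \<^const>\<open>conv\<close> may be
  taken over the whole line, where shifts and reflections are available as substitutions.
\<close>

definition causal :: "(real \<Rightarrow> ennreal) \<Rightarrow> bool" where
  "causal g \<longleftrightarrow> g \<in> borel_measurable borel \<and> (\<forall>x\<le>0. g x = 0)"

lemma causalD:
  assumes "causal g"
  shows causal_measurable: "g \<in> borel_measurable borel" and causal_zero: "\<And>x. x \<le> 0 \<Longrightarrow> g x = 0"
  using assms by (auto simp: causal_def)

lemma conv_cong:
  assumes "\<And>x. 0 < x \<Longrightarrow> g x = g' x" "\<And>x. 0 < x \<Longrightarrow> h x = h' x"
  shows "conv g h t = conv g' h' t"
  unfolding conv_def using assms by (intro nn_integral_cong) (auto split: split_indicator)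

lemma conv_causal:
  assumes "causal g" "causal h"
  shows "conv g h t = (\<integral>\<^sup>+v. g (t - v) * h v \<partial>lborel)"
  unfolding conv_def
proof (intro nn_integral_cong)
  fix v
  show "g (t - v) * h v * indicator {0<..<t} v = g (t - v) * h v"
    using causal_zero[OF assms(1), of "t - v"] causal_zero[OF assms(2), of v]
    by (cases "v \<le> 0"; cases "v < t") (auto split: split_indicator)
qed

lemma causal_conv:
  assumes "causal g" "causal h"
  shows "causal (conv g h)"
proof -
  note [measurable] = causal_measurable[OF assms(1)] causal_measurable[OF assms(2)]
  have "(\<lambda>t. \<integral>\<^sup>+v. g (t - v) * h v \<partial>lborel) \<in> borel_measurable borel"
    by (intro lborel.borel_measurable_nn_integral) simp
  moreover have "conv g h t = 0" if "t \<le> 0" for t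
    using that by (simp add: conv_def)
  ultimately show ?thesis
    unfolding causal_def by (simp add: conv_causal[OF assms, abs_def])
qed

lemma conv_commute:
  assumes "causal g" "causal h"
  shows "conv g h = conv h g"
proof
  fix t
  note [measurable] = causal_measurable[OF assms(1)] causal_measurable[OF assms(2)]
  have "conv g h t = (\<integral>\<^sup>+v. g (t - v) * h v \<partial>lborel)"
    by (rule conv_causal[OF assms])
  also have "\<dots> = (\<integral>\<^sup>+v. g v * h (t - v) \<partial>lborel)"
    by (subst nn_integral_real_affine[where c="-1" and t=t]) auto
  also have "\<dots> = conv h g t"
    by (simp add: conv_causal[OF assms(2,1)] mult.commute)
  finally show "conv g h t = conv h g t" .
qed

lemma conv_assoc:
  assumes "causal f" "causal g" "causal h"
  shows "conv (conv f g) h = conv f (conv g h)"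
proof
  fix t
  note [measurable] = causal_measurable[OF assms(1)] causal_measurable[OF assms(2)]
    causal_measurable[OF assms(3)]
  have "conv (conv f g) h t = (\<integral>\<^sup>+v. (\<integral>\<^sup>+w. f (t - v - w) * g w \<partial>lborel) * h v \<partial>lborel)"
    by (simp add: conv_causal assms causal_conv)
  also have "\<dots> = (\<integral>\<^sup>+v. (\<integral>\<^sup>+w. f (t - v - w) * g w * h v \<partial>lborel) \<partial>lborel)"
    by (intro nn_integral_cong nn_integral_multc[symmetric]) auto
  also have "\<dots> = (\<integral>\<^sup>+v. (\<integral>\<^sup>+w. f (t - w) * g (w - v) * h v \<partial>lborel) \<partial>lborel)"
  proof (rule nn_integral_cong)
    fix v
    show "(\<integral>\<^sup>+w. f (t - v - w) * g w * h v \<partial>lborel) = (\<integral>\<^sup>+w. f (t - w) * g (w - v) * h v \<partial>lborel)"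
      using nn_integral_real_affine[of "\<lambda>w. f (t - w) * g (w - v) * h v" 1 v]
      by (simp add: diff_diff_eq)
  qed
  also have "\<dots> = (\<integral>\<^sup>+w. (\<integral>\<^sup>+v. f (t - w) * g (w - v) * h v \<partial>lborel) \<partial>lborel)"
    by (rule lborel_pair.Fubini') simp
  also have "\<dots> = (\<integral>\<^sup>+w. f (t - w) * (\<integral>\<^sup>+v. g (w - v) * h v \<partial>lborel) \<partial>lborel)"
    by (intro nn_integral_cong) (auto simp: mult.assoc intro!: nn_integral_cmult)
  also have "\<dots> = conv f (conv g h) t"
    by (simp add: conv_causal assms causal_conv)
  finally show "conv (conv f g) h t = conv f (conv g h) t" .
qed

lemma conv_cmult_left:
  assumes "causal g" "causal h"
  shows "conv (\<lambda>x. a * g x) h t = a * conv g h t"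
proof -
  note [measurable] = causal_measurable[OF assms(1)] causal_measurable[OF assms(2)]
  have "causal (\<lambda>x. a * g x)"
    using assms(1) by (auto simp: causal_def)
  then show ?thesis
    using assms by (simp add: conv_causal mult.assoc nn_integral_cmult)
qed

lemma causal_times_id: "causal g \<Longrightarrow> causal (\<lambda>x. ennreal x * g x)"
  by (auto simp: causal_def)

text \<open>
  Multiplication by the argument is a derivation of the convolution algebra, because
  \<open>t = (t - v) + v\<close>.
\<close>

lemma times_id_conv:
  assumes "causal g" "causal h"
  shows "ennreal t * conv g h t =
    conv (\<lambda>x. ennreal x * g x) h t + conv g (\<lambda>x. ennreal x * h x) t"
proof -
  note [measurable] = causal_measurable[OF assms(1)] causal_measurable[OF assms(2)]
  have *: "ennreal t * (g (t - v) * h v * indicator {0<..<t} v) =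
      ennreal (t - v) * g (t - v) * h v * indicator {0<..<t} v +
      g (t - v) * (ennreal v * h v) * indicator {0<..<t} v" for v
  proof (cases "v \<in> {0<..<t}")
    case True
    then have "ennreal t = ennreal (t - v) + ennreal v"
      by (subst ennreal_plus[symmetric]) auto
    then show ?thesis
      by (simp add: algebra_simps)
  qed simp
  show ?thesis
    unfolding conv_def by (subst nn_integral_cmult[symmetric], simp, subst nn_integral_add[symmetric])
      (auto simp: * intro!: nn_integral_cong)
qed

lemma causal_conv_power: "causal g \<Longrightarrow> causal (conv_power g n)"
  by (induction n) (auto simp: causal_conv causal_def[of "\<lambda>_. 0"])

text \<open>
  Values of a density outside \<open>{0<..}\<close> are irrelevant, so a density may be replaced by its
  extension by zero, which is causal.
\<close>

lemma conv_power_cong: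
  assumes "\<And>x. 0 < x \<Longrightarrow> g x = g' x" "0 < x"
  shows "conv_power g n x = conv_power g' n x"
  using assms(2)
proof (induction n arbitrary: x)
  case (Suc n)
  then show ?case
    using assms(1) by (auto intro!: conv_cong)
qed simp

text \<open>
  Probabilistically this is exchangeability: given that \<open>n + 2\<close> independent gaps with density
  \<open>g\<close> add up to \<open>t\<close>, each of them has conditional mean \<open>t / (n + 2)\<close>. Algebraically it is the
  derivation rule applied to a power.
\<close>

lemma times_id_conv_power:
  assumes g: "causal g"
  shows "ennreal t * conv_power g (Suc (Suc n)) t =
    ennreal (n + 2) * conv (conv_power g (Suc n)) (\<lambda>x. ennreal x * g x) t"
proof (induction n arbitrary: t)
  let ?mg = "\<lambda>x. ennreal x * g x"
  note mg = causal_times_id[OF g]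
  {
    case 0
    show ?case
      using fun_cong[OF conv_commute[OF mg g], of t]
      by (simp add: times_id_conv[OF g g] mult_2)
  next
    case (Suc n)
    let ?p = "conv_power g (Suc n)" and ?q = "conv_power g (Suc (Suc n))"
    have p: "causal ?p" and q: "causal ?q"
      using g by (intro causal_conv_power; simp)+
    have "conv (conv ?p ?mg) g = conv ?p (conv ?mg g)"
      by (rule conv_assoc[OF p mg g])
    also have "\<dots> = conv ?p (conv g ?mg)"
      by (simp only: conv_commute[OF mg g])
    also have "\<dots> = conv (conv ?p g) ?mg"
      by (rule conv_assoc[OF p g mg, symmetric])
    also have "conv ?p g = ?q"
      by simp
    finally have "conv (conv ?p ?mg) g = conv ?q ?mg" .
    then have *: "conv (\<lambda>x. ennreal x * ?q x) g t = ennreal (n + 2) * conv ?q ?mg t"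
      unfolding Suc.IH by (subst conv_cmult_left) (simp_all add: p g mg causal_conv del: conv_power.simps)
    have "ennreal t * conv_power g (Suc (Suc (Suc n))) t = ennreal t * conv ?q g t"
      by simp
    also have "\<dots> = ennreal (n + 2) * conv ?q ?mg t + conv ?q ?mg t"
      by (simp only: times_id_conv[OF q g] *)
    also have "\<dots> = (ennreal (n + 2) + 1) * conv ?q ?mg t"
      by (simp add: distrib_right)
    also have "ennreal (n + 2) + 1 = ennreal (Suc n + 2)"
      by (subst ennreal_1[symmetric], subst ennreal_plus[symmetric]) (auto simp: add_ac)
    finally show ?case .
  }
qed

section \<open>Paths of claims and gaps\<close>

text \<open>
  A path is a sequence \<open>z\<close> of pairs: \<open>fst (z i)\<close> is the size of claim number \<open>i\<close>, counted from
  \<open>0\<close>, and \<open>snd (z i)\<close> the gap between claims \<open>i\<close> and \<open>i + 1\<close>. The surplus just before claim \<open>0\<close>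
  is \<open>a\<close>, so the gap before that claim does not belong to the path.
\<close>

definition claim_ruins :: "real \<Rightarrow> real \<Rightarrow> (nat \<Rightarrow> real \<times> real) \<Rightarrow> nat \<Rightarrow> bool" where
  "claim_ruins c a z n \<longleftrightarrow> a + c * (\<Sum>i<n. snd (z i)) < (\<Sum>i\<le>n. fst (z i))"

definition first_ruin :: "real \<Rightarrow> real \<Rightarrow> (nat \<Rightarrow> real \<times> real) \<Rightarrow> nat \<Rightarrow> bool" where
  "first_ruin c a z n \<longleftrightarrow> claim_ruins c a z n \<and> (\<forall>k<n. \<not> claim_ruins c a z k)"

lemma claim_ruins_case_nat_Suc:
  "claim_ruins c a (case_nat (x, t) z) (Suc n) \<longleftrightarrow> claim_ruins c (a - x + c * t) z n"
  unfolding claim_ruins_def by (simp only: sum.lessThan_Suc_shift sum.atMost_Suc_shift)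
    (simp add: algebra_simps)

lemma first_ruin_0: "first_ruin c a (case_nat (x, t) z) 0 \<longleftrightarrow> a < x"
  by (simp add: first_ruin_def claim_ruins_def)

text \<open>
  Surviving the first claim \<open>x\<close> restarts the process with the surplus \<open>a - x + c * t\<close> just before
  the next claim.
\<close>

lemma first_ruin_case_nat_Suc:
  "first_ruin c a (case_nat (x, t) z) (Suc n) \<longleftrightarrow> x \<le> a \<and> first_ruin c (a - x + c * t) z n"
  unfolding first_ruin_def All_less_Suc2 claim_ruins_case_nat_Suc
  by (auto simp: claim_ruins_def[of c a _ 0])

lemma measurable_first_ruin [measurable (raw)]:
  assumes [measurable]: "a \<in> borel_measurable M"
    and [measurable]: "z \<in> M \<rightarrow>\<^sub>M (\<Pi>\<^sub>M i\<in>UNIV. borel \<Otimes>\<^sub>M borel)"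
  shows "Measurable.pred M (\<lambda>w. first_ruin c (a w) (z w) n)"
proof -
  have [measurable]: "(\<lambda>w. z w i) \<in> M \<rightarrow>\<^sub>M borel \<Otimes>\<^sub>M borel" for i
    by measurable
  show ?thesis
    unfolding first_ruin_def claim_ruins_def by measurable
qed

locale exponential_claims =
  fixes c lam :: real and g :: "real \<Rightarrow> ennreal"
  assumes c_pos: "0 < c" and lam_pos: "0 < lam" and causal_g: "causal g"
    and prob_g: "prob_space (density lborel g)"
begin

abbreviation "claim_law \<equiv> density lborel (\<lambda>x. ennreal (exponential_density lam x))"
abbreviation "step_law \<equiv> claim_law \<Otimes>\<^sub>M density lborel g"
abbreviation "path_law \<equiv> (\<Pi>\<^sub>M i\<in>(UNIV::nat set). step_law)"

lemma measurable_g [measurable]: "g \<in> borel_measurable borel"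
  by (rule causal_measurable[OF causal_g])

lemma prob_claim_law: "prob_space claim_law"
  using prob_space_exponential_density[OF lam_pos] by simp

lemma pair_prob_space_step: "pair_prob_space claim_law (density lborel g)"
  using prob_claim_law prob_g
  by (simp add: pair_prob_space_def pair_sigma_finite_def prob_space_imp_sigma_finite)

lemma prob_step_law: "prob_space step_law"
proof -
  interpret pair_prob_space claim_law "density lborel g" by (rule pair_prob_space_step)
  show ?thesis by unfold_locales
qed

lemma sequence_space_step: "sequence_space step_law"
proof -
  interpret prob_space step_law by (rule prob_step_law)
  show ?thesis by unfold_locales
qed

lemma sets_step_law [measurable_cong]: "sets step_law = sets (borel \<Otimes>\<^sub>M borel)"
  by (intro sets_pair_measure_cong) auto

lemma sets_path_law [measurable_cong]:
  "sets path_law = sets (\<Pi>\<^sub>M i\<in>(UNIV::nat set). borel \<Otimes>\<^sub>M borel)"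
  by (intro sets_PiM_cong) (auto simp: sets_step_law)

text \<open>
  Expectations over an i.i.d. path are computed by integrating out its first pair.
\<close>

lemma nn_integral_path_law:
  assumes [measurable]: "F \<in> borel_measurable path_law"
  shows "(\<integral>\<^sup>+z. F z \<partial>path_law) = (\<integral>\<^sup>+x. ennreal (exponential_density lam x) *
    (\<integral>\<^sup>+t. g t * (\<integral>\<^sup>+z. F (case_nat (x, t) z) \<partial>path_law) \<partial>lborel) \<partial>lborel)"
proof -
  interpret sequence_space step_law by (rule sequence_space_step)
  interpret pair_prob_space claim_law "density lborel g" by (rule pair_prob_space_step)
  have [measurable]: "(\<lambda>(s, z). case_nat s z) \<in> step_law \<Otimes>\<^sub>M path_law \<rightarrow>\<^sub>M path_law"
    by measurable
  have "(\<integral>\<^sup>+z. F z \<partial>path_law) = (\<integral>\<^sup>+z. F z \<partial>distr (step_law \<Otimes>\<^sub>M path_law) path_law (\<lambda>(s, z). case_nat s z))"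
    by (simp add: PiM_iter)
  also have "\<dots> = (\<integral>\<^sup>+(s, z). F (case_nat s z) \<partial>(step_law \<Otimes>\<^sub>M path_law))"
    by (subst nn_integral_distr) (auto simp: case_prod_beta')
  also have "\<dots> = (\<integral>\<^sup>+s. \<integral>\<^sup>+z. F (case_nat s z) \<partial>path_law \<partial>step_law)"
    by (subst P.nn_integral_fst[symmetric]) auto
  also have "\<dots> = (\<integral>\<^sup>+x. \<integral>\<^sup>+t. \<integral>\<^sup>+z. F (case_nat (x, t) z) \<partial>path_law \<partial>density lborel g \<partial>claim_law)"
    by (subst M2.nn_integral_fst[symmetric]) auto
  also have "\<dots> = (\<integral>\<^sup>+x. ennreal (exponential_density lam x) *
    (\<integral>\<^sup>+t. \<integral>\<^sup>+z. F (case_nat (x, t) z) \<partial>path_law \<partial>density lborel g) \<partial>lborel)"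
    by (subst nn_integral_density) auto
  also have "\<dots> = (\<integral>\<^sup>+x. ennreal (exponential_density lam x) *
    (\<integral>\<^sup>+t. g t * (\<integral>\<^sup>+z. F (case_nat (x, t) z) \<partial>path_law) \<partial>lborel) \<partial>lborel)"
    by (intro nn_integral_cong arg_cong2[where f="(*)"] refl nn_integral_density) auto
  finally show ?thesis .
qed

end

section \<open>The first-step recursion\<close>

text \<open>
  One more gap \<open>t\<close> is inserted in front of \<open>n + 1\<close> gaps, weighted by the affine function
  \<open>b + c * t\<close>. Given the total \<open>s\<close>, the weight may be replaced by its conditional mean, and
  the mean of \<open>t\<close> is \<open>s / (n + 2)\<close>.
\<close>

lemma conv_weighted_affine:
  assumes g: "causal g" and "0 \<le> b" "0 \<le> c"
  shows "(\<integral>\<^sup>+t. g t * (ennreal (b + c * t) * conv_power g (Suc n) (s - t)) \<partial>lborel) =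
    ennreal (b + c * s / (n + 2)) * conv_power g (Suc (Suc n)) s"
proof -
  let ?p = "conv_power g (Suc n)" and ?q = "conv_power g (Suc (Suc n))"
  let ?mg = "\<lambda>x. ennreal x * g x"
  have p: "causal ?p" and q: "causal ?q"
    using g by (intro causal_conv_power; simp)+
  note mg = causal_times_id[OF g]
  note [measurable] = causal_measurable[OF p] causal_measurable[OF g]
  have conv_mg: "conv ?p ?mg s = ennreal (s / (n + 2)) * ?q s"
  proof (cases "0 < s")
    case True
    have "conv ?p ?mg s = (ennreal (1 / (n + 2)) * ennreal (n + 2)) * conv ?p ?mg s"
      by (subst ennreal_mult[symmetric]) (auto simp del: conv_power.simps)
    also have "\<dots> = ennreal (1 / (n + 2)) * (ennreal s * ?q s)"
      by (simp only: times_id_conv_power[OF g] mult.assoc)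
    also have "\<dots> = ennreal (s / (n + 2)) * ?q s"
      using True by (simp add: mult.assoc[symmetric] ennreal_mult[symmetric] del: conv_power.simps)
    finally show ?thesis .
  next
    case False
    then show ?thesis
      using causal_zero[OF q, of s] causal_zero[OF causal_conv[OF p mg], of s] by simp
  qed
  have "(\<integral>\<^sup>+t. g t * (ennreal (b + c * t) * ?p (s - t)) \<partial>lborel) =
      (\<integral>\<^sup>+t. ennreal b * (?p (s - t) * g t) + ennreal c * (?p (s - t) * ?mg t) \<partial>lborel)"
  proof (intro nn_integral_cong)
    fix t
    show "g t * (ennreal (b + c * t) * ?p (s - t)) =
        ennreal b * (?p (s - t) * g t) + ennreal c * (?p (s - t) * ?mg t)"
      using assms causal_zero[OF g, of t]
      by (cases "0 < t") (auto simp: ennreal_plus ennreal_mult algebra_simps simp del: conv_power.simps)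
  qed
  also have "\<dots> = ennreal b * conv ?p g s + ennreal c * conv ?p ?mg s"
    by (simp add: nn_integral_add nn_integral_cmult conv_causal p g mg del: conv_power.simps)
  also have "conv ?p g s = ?q s"
    by simp
  also have "ennreal b * ?q s + ennreal c * conv ?p ?mg s = ennreal (b + c * s / (n + 2)) * ?q s"
  proof (cases "0 < s")
    case True
    then show ?thesis
      unfolding conv_mg using assms
      by (simp add: ennreal_plus ennreal_mult[symmetric] mult.assoc[symmetric] distrib_right del: conv_power.simps)
  qed (use causal_zero[OF q, of s] in \<open>simp add: conv_mg del: conv_power.simps\<close>)
  finally show ?thesis .
qed

text \<open>
  With \<open>y = a - x\<close> the integrand is the derivative of \<open>y * (y + r) ^ (n + 1) / (n + 2)\<close>: this is
  what makes the polynomials \<open>a * (a + r) ^ n\<close> (Abel polynomials) reproduce themselves under the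
  first-step recursion.
\<close>

lemma nn_integral_Abel_step:
  assumes "0 \<le> a" "0 \<le> r"
  shows "(\<integral>\<^sup>+x. ennreal ((a - x + r) ^ n * (a - x + r / (n + 2))) * indicator {0..a} x \<partial>lborel) =
    ennreal (a * (a + r) ^ Suc n / (n + 2))"
proof -
  let ?F = "\<lambda>x. - ((a - x) * (a - x + r) ^ Suc n / (n + 2))"
  have "(\<integral>\<^sup>+x. ennreal ((a - x + r) ^ n * (a - x + r / (n + 2))) * indicator {0..a} x \<partial>lborel) =
      ennreal (?F a - ?F 0)"
  proof (rule nn_integral_FTC_Icc)
    fix x assume x: "x \<in> {0..a}"
    have "((a - x + r) ^ Suc n + (a - x) * (Suc n * (a - x + r) ^ n)) / (n + 2) =
        (a - x + r) ^ n * (a - x + r / (n + 2))"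
      by (simp add: divide_simps) (simp add: algebra_simps)
    moreover have "(?F has_real_derivative
        ((a - x + r) ^ Suc n + (a - x) * (Suc n * (a - x + r) ^ n)) / (n + 2)) (at x)"
      by (rule derivative_eq_intros refl | simp)+ (simp add: field_simps)
    ultimately show "(?F has_real_derivative (a - x + r) ^ n * (a - x + r / (n + 2))) (at x)"
      by simp
    show "0 \<le> (a - x + r) ^ n * (a - x + r / (n + 2))"
      using x assms by simp
  qed (use assms in auto)
  then show ?thesis by (simp add: add.commute)
qed

context exponential_claims
begin

text \<open>
  The law of the time from claim \<open>0\<close> to the ruinous claim, restricted to the event that this is
  claim \<open>n\<close>, is described by its integrals against test functions \<open>\<phi>\<close>: this covers the atom at
  \<open>0\<close> for \<open>n = 0\<close> and the absolutely continuous case \<open>n > 0\<close> alike, and lets \<open>\<phi>\<close> absorb the first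
  gap in the recursion.
\<close>

definition ruin_functional :: "nat \<Rightarrow> real \<Rightarrow> (real \<Rightarrow> ennreal) \<Rightarrow> ennreal" where
  "ruin_functional n a \<phi> =
    (\<integral>\<^sup>+z. indicator {z. first_ruin c a z n} z * \<phi> (\<Sum>i<n. snd (z i)) \<partial>path_law)"

text \<open>
  The index is shifted: for \<open>a \<ge> 0\<close>, \<open>ruin_kernel n a r\<close> will turn out to be the conditional
  probability, given that the first \<open>n + 1\<close> gaps add up to \<open>r\<close>, that claim \<open>n + 1\<close> is the first
  ruinous one.
\<close>

definition ruin_kernel :: "nat \<Rightarrow> real \<Rightarrow> real \<Rightarrow> real" where
  "ruin_kernel n a r =
    exp (- lam * (a + c * r)) * lam ^ Suc n * a * (a + c * r) ^ n / fact (Suc n)"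

lemma measurable_ruin_integrand [measurable]:
  assumes [measurable]: "\<phi> \<in> borel_measurable borel"
  shows "(\<lambda>z. indicator {z. first_ruin c a z n} z * (\<phi> (\<Sum>i<n. snd (z i)) :: ennreal)) \<in> borel_measurable path_law"
proof -
  have [measurable]: "(\<lambda>z. z i) \<in> path_law \<rightarrow>\<^sub>M borel \<Otimes>\<^sub>M borel" for i
    by measurable
  have [measurable]: "(\<lambda>z. z) \<in> path_law \<rightarrow>\<^sub>M (\<Pi>\<^sub>M i\<in>UNIV. borel \<Otimes>\<^sub>M borel)"
    by (intro measurable_ident_sets sets_path_law)
  have [measurable]: "Measurable.pred path_law (\<lambda>z. first_ruin c a z n)"
    by (rule measurable_first_ruin) measurable
  show ?thesis
    unfolding indicator_def mem_Collect_eq by measurable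
qed

text \<open>
  The sum of no gaps is \<open>0\<close>, and only the exponential tail of the first claim matters.
\<close>

lemma ruin_functional_0:
  assumes "0 \<le> a" and [measurable]: "\<phi> \<in> borel_measurable borel"
  shows "ruin_functional 0 a \<phi> = ennreal (exp (- lam * a)) * \<phi> 0"
proof -
  interpret path: prob_space path_law
    using prob_step_law by (intro prob_space_PiM)
  interpret claim: prob_space claim_law by (rule prob_claim_law)
  interpret gap: prob_space "density lborel g" by (rule prob_g)
  have gap: "(\<integral>\<^sup>+t. g t \<partial>lborel) = 1"
    using gap.emeasure_space_1 by (simp add: emeasure_density)
  have "distributed claim_law lborel (\<lambda>x. x) (exponential_density lam)"
    by (auto simp: distributed_def distr_id2)
  then have "measure claim_law {x \<in> space claim_law. a < x} = exp (- a * lam)"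
    by (rule claim.exponential_distributedD_gt) (use assms lam_pos in auto)
  then have tail: "emeasure claim_law {a<..} = ennreal (exp (- lam * a))"
    by (simp add: claim.emeasure_eq_measure greaterThan_def mult.commute)
  have "ruin_functional 0 a \<phi> = (\<integral>\<^sup>+x. ennreal (exponential_density lam x) *
      (\<integral>\<^sup>+t. g t * (\<integral>\<^sup>+z. indicator {a<..} x * \<phi> 0 \<partial>path_law) \<partial>lborel) \<partial>lborel)"
    unfolding ruin_functional_def by (subst nn_integral_path_law)
      (auto simp: indicator_def first_ruin_0)
  also have "\<dots> = (\<integral>\<^sup>+x. ennreal (exponential_density lam x) * indicator {a<..} x * \<phi> 0 \<partial>lborel)"
    by (simp add: path.emeasure_space_1 nn_integral_multc gap mult.assoc)
  also have "\<dots> = emeasure claim_law {a<..} * \<phi> 0"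
    by (simp add: nn_integral_multc emeasure_density)
  finally show ?thesis
    by (simp add: tail)
qed

lemma ruin_functional_Suc:
  assumes [measurable]: "\<phi> \<in> borel_measurable borel"
  shows "ruin_functional (Suc n) a \<phi> =
    (\<integral>\<^sup>+x. ennreal (exponential_density lam x) * (\<integral>\<^sup>+t. g t * (indicator {..a} x *
      ruin_functional n (a - x + c * t) (\<lambda>r. \<phi> (t + r))) \<partial>lborel) \<partial>lborel)"
  unfolding ruin_functional_def
proof (subst nn_integral_path_law)
  show "(\<integral>\<^sup>+x. ennreal (exponential_density lam x) * (\<integral>\<^sup>+t. g t * (\<integral>\<^sup>+z.
      indicator {z. first_ruin c a z (Suc n)} (case_nat (x, t) z) *
      \<phi> (\<Sum>i<Suc n. snd (case i of 0 \<Rightarrow> (x, t) | Suc j \<Rightarrow> z j)) \<partial>path_law) \<partial>lborel) \<partial>lborel) =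
    (\<integral>\<^sup>+x. ennreal (exponential_density lam x) * (\<integral>\<^sup>+t. g t * (indicator {..a} x *
      (\<integral>\<^sup>+z. indicator {z. first_ruin c (a - x + c * t) z n} z * \<phi> (t + (\<Sum>i<n. snd (z i)))
        \<partial>path_law)) \<partial>lborel) \<partial>lborel)"
    by (intro nn_integral_cong arg_cong2[where f="(*)"] refl, subst nn_integral_cmult[symmetric])
      (auto simp: first_ruin_case_nat_Suc indicator_def sum.lessThan_Suc_shift simp del: sum.lessThan_Suc
        intro!: nn_integral_cong)
qed auto

text \<open>
  The exponents of a claim \<open>x\<close> and of the surplus left after it add up to one that no longer
  depends on \<open>x\<close> (lack of memory); only the polynomial factor remains to be integrated over \<open>x\<close>.
\<close>

lemma exponential_density_times_ruin_kernel:
  assumes "0 \<le> x"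
  shows "exponential_density lam x * ruin_kernel n (a - x + c * t) (s - t) =
    lam ^ (n + 2) * exp (- lam * (a + c * s)) / fact (Suc n) *
      (a - x + c * s) ^ n * (a - x + c * t)"
proof -
  have e: "exp (- lam * (a + c * s)) =
      exp (- x * lam) * exp (- lam * (a - x + c * t + c * (s - t)))"
    by (simp add: exp_add[symmetric] algebra_simps)
  have b: "a - x + c * s = a - x + c * t + c * (s - t)"
    by (simp add: algebra_simps)
  show ?thesis
    unfolding e b using assms
    by (simp add: exponential_density_def erlang_density_def ruin_kernel_def del: fact_Suc)
qed

text \<open>
  Induction on the number of survived claims, through the first claim \<open>x\<close> and the first gap \<open>t\<close>.
  With the total \<open>s\<close> of all gaps held fixed, integrating out \<open>t\<close> is the weighted convolution
  identity, and integrating out \<open>x\<close> is the Abel polynomial identity.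
\<close>

lemma ruin_functional_formula:
  assumes "0 \<le> a" and "\<phi> \<in> borel_measurable borel"
  shows "ruin_functional (Suc n) a \<phi> =
    (\<integral>\<^sup>+r. ennreal (ruin_kernel n a r) * (conv_power g (Suc n) r * \<phi> r) \<partial>lborel)"
  using assms
proof (induction n arbitrary: a \<phi>)
  case 0
  note [measurable] = 0(2)
  have pos: "0 \<le> c" "0 \<le> lam" using c_pos lam_pos by auto
  let ?I = "\<integral>\<^sup>+t. ennreal (exp (- lam * (a + c * t))) * (g t * \<phi> t) \<partial>lborel"
  have "ruin_functional (Suc 0) a \<phi> =
      (\<integral>\<^sup>+x. ennreal (exponential_density lam x) * (\<integral>\<^sup>+t. g t * (indicator {..a} x *
        (ennreal (exp (- lam * (a - x + c * t))) * \<phi> t)) \<partial>lborel) \<partial>lborel)"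
    unfolding ruin_functional_Suc[OF 0(2)]
  proof (rule nn_integral_cong, rule arg_cong2[where f="(*)"], rule refl, rule nn_integral_cong)
    fix x t
    show "g t * (indicator {..a} x * ruin_functional 0 (a - x + c * t) (\<lambda>r. \<phi> (t + r))) =
        g t * (indicator {..a} x * (ennreal (exp (- lam * (a - x + c * t))) * \<phi> t))"
      using pos by (cases "0 < t"; cases "x \<le> a") (auto simp: ruin_functional_0 causal_zero[OF causal_g])
  qed
  also have "\<dots> = (\<integral>\<^sup>+x. ennreal lam * indicator {0..a} x * ?I \<partial>lborel)"
  proof (intro nn_integral_cong)
    fix x
    show "ennreal (exponential_density lam x) * (\<integral>\<^sup>+t. g t * (indicator {..a} x *
        (ennreal (exp (- lam * (a - x + c * t))) * \<phi> t)) \<partial>lborel) = ennreal lam * indicator {0..a} x * ?I"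
    proof (cases "x \<in> {0..a}")
      case True
      have "exponential_density lam x * exp (- lam * (a - x + c * t)) = lam * exp (- lam * (a + c * t))" for t
        using True by (simp add: exponential_density_def erlang_density_def exp_add[symmetric] algebra_simps)
      then have *: "ennreal (exponential_density lam x) * (ennreal (exp (- lam * (a - x + c * t))) * y)
          = ennreal lam * (ennreal (exp (- lam * (a + c * t))) * y)" for t y
        using pos True by (simp add: mult.assoc[symmetric] ennreal_mult'[symmetric])
      have "ennreal (exponential_density lam x) * (\<integral>\<^sup>+t. g t * (indicator {..a} x *
          (ennreal (exp (- lam * (a - x + c * t))) * \<phi> t)) \<partial>lborel) =
        (\<integral>\<^sup>+t. ennreal (exponential_density lam x) * (g t * (indicator {..a} x *
          (ennreal (exp (- lam * (a - x + c * t))) * \<phi> t))) \<partial>lborel)"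
        by (rule nn_integral_cmult[symmetric]) simp
      also have "\<dots> = (\<integral>\<^sup>+t. ennreal (exponential_density lam x) *
          (ennreal (exp (- lam * (a - x + c * t))) * (g t * \<phi> t)) \<partial>lborel)"
        using True by (intro nn_integral_cong) (simp add: mult_ac)
      also have "\<dots> = ennreal lam * ?I"
        unfolding * by (rule nn_integral_cmult) simp
      finally show ?thesis
        using True by simp
    qed (auto simp: exponential_density_def erlang_density_def)
  qed
  also have "\<dots> = ennreal (lam * a) * ?I"
    using 0 pos by (simp add: nn_integral_multc nn_integral_cmult ennreal_mult)
  also have "\<dots> = (\<integral>\<^sup>+t. ennreal (ruin_kernel 0 a t) * (g t * \<phi> t) \<partial>lborel)"
  proof -
    have "ennreal (lam * a) * (ennreal (exp (- lam * (a + c * t))) * y) = ennreal (ruin_kernel 0 a t) * y" for t y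
    proof -
      have "ruin_kernel 0 a t = lam * a * exp (- lam * (a + c * t))"
        by (simp add: ruin_kernel_def)
      moreover have "ennreal (lam * a * exp (- lam * (a + c * t))) =
          ennreal (lam * a) * ennreal (exp (- lam * (a + c * t)))"
        using 0 pos by (intro ennreal_mult) auto
      ultimately show ?thesis by (simp only: mult.assoc)
    qed
    moreover have "ennreal (lam * a) * ?I = (\<integral>\<^sup>+t. ennreal (lam * a) *
        (ennreal (exp (- lam * (a + c * t))) * (g t * \<phi> t)) \<partial>lborel)"
      by (rule nn_integral_cmult[symmetric]) simp
    ultimately show ?thesis by (simp only:)
  qed
  finally show ?case by simp
next
  case (Suc n)
  note [measurable] = Suc.prems(2)
  have pos: "0 \<le> c" "0 \<le> lam" using c_pos lam_pos by auto
  define p where "p = conv_power g (Suc n)"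
  define q where "q = conv_power g (Suc (Suc n))"
  have p: "causal p" and q: "causal q"
    unfolding p_def q_def using causal_g by (rule causal_conv_power)+
  note [measurable] = causal_measurable[OF p] causal_measurable[OF q]
  \<comment> \<open>The part of the integrand that depends neither on the first claim nor on the first gap.\<close>
  define C where "C s = lam ^ (n + 2) * exp (- lam * (a + c * s)) / fact (Suc n)" for s
  have [measurable]: "C \<in> borel_measurable borel" and C_nonneg: "\<And>s. 0 \<le> C s"
    unfolding C_def using pos by (auto simp del: fact_Suc)
  define J where "J x t = (\<integral>\<^sup>+r. ennreal (ruin_kernel n (a - x + c * t) r) * (p r * \<phi> (t + r)) \<partial>lborel)" for x t
  have [measurable]: "J x \<in> borel_measurable borel" for x
    unfolding J_def ruin_kernel_def by measurable
  define w where "w x s = ennreal (C s) * ennreal ((a - x + c * s) ^ n) * \<phi> s" for x s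
  have [measurable]: "(\<lambda>s. w x s) \<in> borel_measurable borel" for x
    unfolding w_def by measurable
  \<comment> \<open>After the shift \<open>r = s - t\<close> the variable \<open>s\<close> is the total of all gaps.\<close>
  have shift: "ennreal (exponential_density lam x) * (g t * J x t) =
      (\<integral>\<^sup>+s. w x s * (g t * (ennreal (a - x + c * t) * p (s - t))) \<partial>lborel)" if x: "0 \<le> x" "x \<le> a" for x t
  proof -
    have "J x t = (\<integral>\<^sup>+s. ennreal (ruin_kernel n (a - x + c * t) (s - t)) * (p (s - t) * \<phi> s) \<partial>lborel)"
      unfolding J_def by (subst nn_integral_real_affine[where c=1 and t="-t"]) (auto simp: ruin_kernel_def)
    then have "ennreal (exponential_density lam x) * (g t * J x t) =
        (\<integral>\<^sup>+s. ennreal (exponential_density lam x) *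
          (g t * (ennreal (ruin_kernel n (a - x + c * t) (s - t)) * (p (s - t) * \<phi> s))) \<partial>lborel)"
      by (simp add: nn_integral_cmult ruin_kernel_def)
    also have "\<dots> = (\<integral>\<^sup>+s. w x s * (g t * (ennreal (a - x + c * t) * p (s - t))) \<partial>lborel)"
    proof (intro nn_integral_cong)
      fix s
      show "ennreal (exponential_density lam x) *
            (g t * (ennreal (ruin_kernel n (a - x + c * t) (s - t)) * (p (s - t) * \<phi> s))) =
          w x s * (g t * (ennreal (a - x + c * t) * p (s - t)))"
      proof (cases "0 < t \<and> t < s")
        case True
        have "ennreal (exponential_density lam x) * ennreal (ruin_kernel n (a - x + c * t) (s - t)) =
            ennreal (C s * (a - x + c * s) ^ n * (a - x + c * t))"
          unfolding C_def exponential_density_times_ruin_kernel[OF x(1), symmetric]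
          by (rule ennreal_mult'[symmetric]) (use lam_pos in auto)
        also have "\<dots> = ennreal (C s) * ennreal ((a - x + c * s) ^ n) * ennreal (a - x + c * t)"
          using True x pos C_nonneg[of s] by (simp add: ennreal_mult)
        finally have *: "ennreal (exponential_density lam x) * ennreal (ruin_kernel n (a - x + c * t) (s - t)) =
          ennreal (C s) * ennreal ((a - x + c * s) ^ n) * ennreal (a - x + c * t)" .
        have "ennreal (exponential_density lam x) *
            (g t * (ennreal (ruin_kernel n (a - x + c * t) (s - t)) * (p (s - t) * \<phi> s))) =
          (ennreal (exponential_density lam x) * ennreal (ruin_kernel n (a - x + c * t) (s - t))) *
            (g t * (p (s - t) * \<phi> s))"
          by (simp only: mult_ac)
        also have "\<dots> = w x s * (g t * (ennreal (a - x + c * t) * p (s - t)))"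
          unfolding * w_def by (simp only: mult_ac)
        finally show ?thesis .
      qed (auto simp: causal_zero[OF p] causal_zero[OF causal_g] not_less)
    qed
    finally show ?thesis .
  qed
  have "ruin_functional (Suc (Suc n)) a \<phi> =
      (\<integral>\<^sup>+x. indicator {0..a} x * (ennreal (exponential_density lam x) * (\<integral>\<^sup>+t. g t * J x t \<partial>lborel)) \<partial>lborel)"
    unfolding ruin_functional_Suc[OF Suc.prems(2), of "Suc n"]
  proof (intro nn_integral_cong)
    fix x
    show "ennreal (exponential_density lam x) * (\<integral>\<^sup>+t. g t * (indicator {..a} x *
        ruin_functional (Suc n) (a - x + c * t) (\<lambda>r. \<phi> (t + r))) \<partial>lborel) =
      indicator {0..a} x * (ennreal (exponential_density lam x) * (\<integral>\<^sup>+t. g t * J x t \<partial>lborel))"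
    proof (cases "x \<in> {0..a}")
      case True
      have "g t * (indicator {..a} x * ruin_functional (Suc n) (a - x + c * t) (\<lambda>r. \<phi> (t + r))) = g t * J x t" for t
      proof (cases "0 < t")
        case t: True
        have "ruin_functional (Suc n) (a - x + c * t) (\<lambda>r. \<phi> (t + r)) = J x t"
          unfolding J_def p_def by (rule Suc.IH) (use t True pos in auto)
        then show ?thesis using True by simp
      qed (auto simp: causal_zero[OF causal_g])
      then show ?thesis using True by simp
    qed (auto simp: exponential_density_def erlang_density_def)
  qed
  also have "\<dots> = (\<integral>\<^sup>+x. indicator {0..a} x * (\<integral>\<^sup>+s. w x s * (ennreal (a - x + c * s / (n + 2)) * q s) \<partial>lborel) \<partial>lborel)"
  proof (intro nn_integral_cong)
    fix x
    show "indicator {0..a} x * (ennreal (exponential_density lam x) * (\<integral>\<^sup>+t. g t * J x t \<partial>lborel)) =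
      indicator {0..a} x * (\<integral>\<^sup>+s. w x s * (ennreal (a - x + c * s / (n + 2)) * q s) \<partial>lborel)"
    proof (cases "x \<in> {0..a}")
      case True
      then have x: "0 \<le> x" "x \<le> a" by auto
      have "ennreal (exponential_density lam x) * (\<integral>\<^sup>+t. g t * J x t \<partial>lborel) =
          (\<integral>\<^sup>+t. ennreal (exponential_density lam x) * (g t * J x t) \<partial>lborel)"
        by (rule nn_integral_cmult[symmetric]) simp
      also have "\<dots> = (\<integral>\<^sup>+t. \<integral>\<^sup>+s. w x s * (g t * (ennreal (a - x + c * t) * p (s - t))) \<partial>lborel \<partial>lborel)"
        by (simp only: shift[OF x])
      also have "\<dots> = (\<integral>\<^sup>+s. \<integral>\<^sup>+t. w x s * (g t * (ennreal (a - x + c * t) * p (s - t))) \<partial>lborel \<partial>lborel)"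
        by (rule lborel_pair.Fubini') simp
      also have "\<dots> = (\<integral>\<^sup>+s. w x s * (\<integral>\<^sup>+t. g t * (ennreal (a - x + c * t) * p (s - t)) \<partial>lborel) \<partial>lborel)"
        by (intro nn_integral_cong) (simp add: nn_integral_cmult)
      also have "\<dots> = (\<integral>\<^sup>+s. w x s * (ennreal (a - x + c * s / (n + 2)) * q s) \<partial>lborel)"
        unfolding p_def q_def using x pos
        by (subst conv_weighted_affine[OF causal_g]) auto
      finally show ?thesis by simp
    qed simp
  qed
  also have "\<dots> = (\<integral>\<^sup>+x. \<integral>\<^sup>+s. indicator {0..a} x * (w x s * (ennreal (a - x + c * s / (n + 2)) * q s)) \<partial>lborel \<partial>lborel)"
    by (intro nn_integral_cong nn_integral_cmult[symmetric]) simp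
  also have "\<dots> = (\<integral>\<^sup>+s. \<integral>\<^sup>+x. indicator {0..a} x * (w x s * (ennreal (a - x + c * s / (n + 2)) * q s)) \<partial>lborel \<partial>lborel)"
    unfolding w_def by (rule lborel_pair.Fubini') simp
  also have "\<dots> = (\<integral>\<^sup>+s. ennreal (ruin_kernel (Suc n) a s) * (q s * \<phi> s) \<partial>lborel)"
  proof (rule nn_integral_cong)
    fix s
    show "(\<integral>\<^sup>+x. indicator {0..a} x * (w x s * (ennreal (a - x + c * s / (n + 2)) * q s)) \<partial>lborel) =
      ennreal (ruin_kernel (Suc n) a s) * (q s * \<phi> s)"
    proof (cases "0 < s")
      case True
      have "(\<integral>\<^sup>+x. indicator {0..a} x * (w x s * (ennreal (a - x + c * s / (n + 2)) * q s)) \<partial>lborel) =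
        (\<integral>\<^sup>+x. (ennreal (C s) * (q s * \<phi> s)) *
          (ennreal ((a - x + c * s) ^ n * (a - x + c * s / (n + 2))) * indicator {0..a} x) \<partial>lborel)"
      proof (intro nn_integral_cong)
        fix x
        show "indicator {0..a} x * (w x s * (ennreal (a - x + c * s / (n + 2)) * q s)) =
          (ennreal (C s) * (q s * \<phi> s)) *
            (ennreal ((a - x + c * s) ^ n * (a - x + c * s / (n + 2))) * indicator {0..a} x)"
        proof (cases "x \<in> {0..a}")
          case x: True
          then have "ennreal ((a - x + c * s) ^ n * (a - x + c * s / (n + 2))) =
              ennreal ((a - x + c * s) ^ n) * ennreal (a - x + c * s / (n + 2))"
            using True pos by (intro ennreal_mult) auto
          then show ?thesis
            unfolding w_def by (simp only: mult_ac)
        qed simp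
      qed
      also have "\<dots> = (ennreal (C s) * (q s * \<phi> s)) * ennreal (a * (a + c * s) ^ Suc n / (n + 2))"
        using nn_integral_Abel_step[OF Suc.prems(1), of "c * s" n] True pos
        by (simp add: nn_integral_cmult add.commute)
      also have "\<dots> = (ennreal (C s) * ennreal (a * (a + c * s) ^ Suc n / (n + 2))) * (q s * \<phi> s)"
        by (simp only: mult_ac)
      also have "ennreal (C s) * ennreal (a * (a + c * s) ^ Suc n / (n + 2)) =
          ennreal (C s * (a * (a + c * s) ^ Suc n / (n + 2)))"
        by (rule ennreal_mult[symmetric]) (use C_nonneg Suc.prems(1) True pos in auto)
      also have "C s * (a * (a + c * s) ^ Suc n / (n + 2)) = ruin_kernel (Suc n) a s"
        unfolding C_def ruin_kernel_def fact_Suc[of "Suc n"]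
        by (simp del: fact_Suc add: mult_ac add_ac)
      finally show ?thesis .
    qed (simp add: causal_zero[OF q])
  qed
  finally show ?case
    unfolding q_def .
qed

end

section \<open>The ruin time as the time of the first ruinous claim\<close>

lemma claim_count_eq_Least:
  "claim_count T s \<omega> =
    (if \<exists>j. s \<le> (\<Sum>i\<le>j. T i \<omega>) then enat (LEAST j. s \<le> (\<Sum>i\<le>j. T i \<omega>)) else \<infinity>)"
proof (cases "\<exists>j. s \<le> (\<Sum>i\<le>j. T i \<omega>)")
  case True
  then have "(INF j\<in>{j. s \<le> (\<Sum>i\<le>j. T i \<omega>)}. enat j) = enat (LEAST j. s \<le> (\<Sum>i\<le>j. T i \<omega>))"
    by (intro antisym INF_lower INF_greatest) (auto intro: LeastI_ex Least_le)
  with True show ?thesis by (simp add: claim_count_def)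
qed (simp add: claim_count_def top_enat_def)

lemma claim_count_eqI:
  assumes "s \<le> (\<Sum>i\<le>m. T i \<omega>)" "\<And>j. j < m \<Longrightarrow> (\<Sum>i\<le>j. T i \<omega>) < s"
  shows "claim_count T s \<omega> = enat m"
proof -
  have "(LEAST j. s \<le> (\<Sum>i\<le>j. T i \<omega>)) = m"
    using assms by (intro Least_equality) (auto simp: not_le[symmetric])
  then show ?thesis
    using assms(1) by (auto simp: claim_count_eq_Least)
qed

lemma surplus_eq:
  assumes "claim_count T s \<omega> = enat m"
  shows "surplus u c T X s \<omega> = u + c * s - (\<Sum>j=1..m. X j \<omega>)"
proof -
  have "{j. 1 \<le> j \<and> enat j \<le> claim_count T s \<omega>} = {1..m}"
    using assms by auto
  then show ?thesis by (simp add: surplus_def)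
qed

lemma negative_surplus_claim_count:
  assumes "surplus u c T X s \<omega> < 0" "0 \<le> u" "0 \<le> c" "0 \<le> s"
  obtains m where "claim_count T s \<omega> = enat (Suc m)"
proof (cases "claim_count T s \<omega>")
  case (enat m)
  have "0 \<le> u + c * s"
    using assms by simp
  with enat show ?thesis
    using assms(1) surplus_eq[OF enat, of u c X] that by (cases m) auto
next
  case infinity
  have "infinite {j::nat. 1 \<le> j}"
    using infinite_Ici[of "1::nat"] by (simp add: atLeast_def)
  then have "surplus u c T X s \<omega> = u + c * s"
    by (simp add: surplus_def infinity)
  moreover have "0 \<le> u + c * s"
    using assms by simp
  ultimately show ?thesis using assms(1) by simp
qed

text \<open>
  \<^const>\<open>claim_count\<close> is left-continuous in time and the premium is continuous, so a negative
  surplus was negative on an interval to the left already. This holds for every outcome, also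
  for those where some gap is not positive.
\<close>

lemma negative_surplus_just_before:
  assumes neg: "surplus u c T X s \<omega> < 0" and "0 \<le> u" "0 \<le> c" "0 < s"
  obtains b where "0 \<le> b" "b < s" "\<And>q. b < q \<Longrightarrow> q \<le> s \<Longrightarrow> surplus u c T X q \<omega> < 0"
proof -
  let ?S = "\<lambda>j. \<Sum>i\<le>j. T i \<omega>"
  obtain m where m: "claim_count T s \<omega> = enat (Suc m)"
    using assms by (auto elim: negative_surplus_claim_count)
  then have ex: "\<exists>j. s \<le> ?S j" and Least: "Suc m = (LEAST j. s \<le> ?S j)"
    by (auto simp: claim_count_eq_Least split: if_splits)
  have reach: "s \<le> ?S (Suc m)"
    unfolding Least using ex by (rule LeastI_ex)
  have below: "?S j < s" if "j < Suc m" for j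
    using not_less_Least[of j "\<lambda>j. s \<le> ?S j"] that Least by auto
  define b where "b = Max (insert 0 (?S ` {..m}))"
  show thesis
  proof
    show "0 \<le> b" by (simp add: b_def)
    show "b < s" using below \<open>0 < s\<close> by (auto simp: b_def)
    fix q assume q: "b < q" "q \<le> s"
    have "claim_count T q \<omega> = enat (Suc m)"
    proof (rule claim_count_eqI)
      show "q \<le> ?S (Suc m)" using q reach by simp
      show "?S j < q" if "j < Suc m" for j
      proof -
        have "?S j \<le> b" unfolding b_def using that by (intro Max_ge) auto
        with q show ?thesis by simp
      qed
    qed
    moreover have "c * q \<le> c * s"
      using q \<open>0 \<le> c\<close> by (intro mult_left_mono) auto
    ultimately show "surplus u c T X q \<omega> < 0"
      using neg surplus_eq[OF m, of u c X] surplus_eq[of T q \<omega> "Suc m" u c X] by simp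
  qed
qed

text \<open>
  The uncountable infimum reduces to a countable one; this is how the ruin time is seen to be
  measurable on the whole space and not merely up to a null set.
\<close>

lemma ruin_time_eq_INF_Rats:
  assumes "0 \<le> u" "0 \<le> c"
  shows "ruin_time u c T X \<omega> =
    (INF q\<in>\<rat> \<inter> {0<..}. if surplus u c T X q \<omega> < 0 then ereal q else \<infinity>)"
  unfolding ruin_time_def
proof (intro antisym INF_greatest)
  fix q :: real assume "q \<in> \<rat> \<inter> {0<..}"
  then show "(INF t\<in>{t. 0 < t \<and> surplus u c T X t \<omega> < 0}. ereal t)
      \<le> (if surplus u c T X q \<omega> < 0 then ereal q else \<infinity>)"
    by (auto intro!: INF_lower)
next
  fix s assume "s \<in> {t. 0 < t \<and> surplus u c T X t \<omega> < 0}"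
  then obtain b where b: "0 \<le> b" "b < s" "\<And>q. b < q \<Longrightarrow> q \<le> s \<Longrightarrow> surplus u c T X q \<omega> < 0"
    using assms by (auto elim: negative_surplus_just_before)
  then obtain q where q: "q \<in> \<rat>" "b < q" "q < s"
    using Rats_dense_in_real by blast
  have "(INF q\<in>\<rat> \<inter> {0<..}. if surplus u c T X q \<omega> < 0 then ereal q else \<infinity>)
      \<le> (if surplus u c T X q \<omega> < 0 then ereal q else \<infinity>)"
    using q b(1) by (intro INF_lower) auto
  also have "\<dots> \<le> ereal s"
    using b(3)[of q] q by auto
  finally show "(INF q\<in>\<rat> \<inter> {0<..}. if surplus u c T X q \<omega> < 0 then ereal q else \<infinity>) \<le> ereal s" .
qed

lemma measurable_ruin_time:
  assumes T: "\<And>j. T j \<in> borel_measurable M" and X: "\<And>j. 1 \<le> j \<Longrightarrow> X j \<in> borel_measurable M"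
    and "0 \<le> u" "0 \<le> c"
  shows "ruin_time u c T X \<in> borel_measurable M"
proof -
  note [measurable] = T
  have "claim_count T s \<in> M \<rightarrow>\<^sub>M count_space UNIV" for s
    unfolding claim_count_eq_Least[abs_def] by measurable
  moreover have "(\<lambda>\<omega>. u + c * s - (\<Sum>j | 1 \<le> j \<and> enat j \<le> e. X j \<omega>)) \<in> borel_measurable M" for s e
    using X by (intro borel_measurable_diff borel_measurable_const borel_measurable_sum) auto
  ultimately have [measurable]: "surplus u c T X s \<in> borel_measurable M" for s
    unfolding surplus_def[abs_def]
    by (rule measurable_compose_countable[where g = "claim_count T s", rotated])
  have "countable (\<rat> \<inter> {0<..} :: real set)"
    using countable_rat by (rule countable_subset[rotated]) auto
  then show ?thesis
    unfolding ruin_time_eq_INF_Rats[OF assms(3,4), abs_def] by (intro borel_measurable_INF) measurable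
qed

context
  fixes T X :: "nat \<Rightarrow> 'a \<Rightarrow> real" and u c :: real and \<omega> :: 'a
  assumes gaps: "\<And>j. 0 < T j \<omega>" and u_nonneg: "0 \<le> u" and c_pos: "0 < c"
begin

lemma partial_sums_strict_mono: "i < j \<Longrightarrow> (\<Sum>k\<le>i. T k \<omega>) < (\<Sum>k\<le>j. T k \<omega>)"
  by (rule strict_monoD[of "\<lambda>j. \<Sum>k\<le>j. T k \<omega>"]) (auto simp: strict_mono_Suc_iff gaps)

text \<open>
  Times \<open>s\<close> beyond all partial sums do not occur on the right: there the claim count is infinite,
  the claims are summed over an infinite set, which gives \<open>0\<close>, and the surplus is nonnegative.
\<close>

lemma negative_surplus_iff:
  assumes "0 < s"
  shows "surplus u c T X s \<omega> < 0 \<longleftrightarrow>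
    (\<exists>n. (\<Sum>i\<le>n. T i \<omega>) < s \<and> s \<le> (\<Sum>i\<le>Suc n. T i \<omega>) \<and> u + c * s < (\<Sum>j=1..Suc n. X j \<omega>))"
proof
  assume neg: "surplus u c T X s \<omega> < 0"
  obtain n where n: "claim_count T s \<omega> = enat (Suc n)"
    using neg u_nonneg c_pos assms by (auto elim: negative_surplus_claim_count)
  then have ex: "\<exists>j. s \<le> (\<Sum>i\<le>j. T i \<omega>)" and Least: "Suc n = (LEAST j. s \<le> (\<Sum>i\<le>j. T i \<omega>))"
    by (auto simp only: claim_count_eq_Least split: if_splits)
  have "s \<le> (\<Sum>i\<le>Suc n. T i \<omega>)"
    unfolding Least using ex by (rule LeastI_ex)
  moreover have "\<not> s \<le> (\<Sum>i\<le>n. T i \<omega>)"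
    using Least by (intro not_less_Least) auto
  ultimately show "\<exists>n. (\<Sum>i\<le>n. T i \<omega>) < s \<and> s \<le> (\<Sum>i\<le>Suc n. T i \<omega>) \<and> u + c * s < (\<Sum>j=1..Suc n. X j \<omega>)"
    using neg surplus_eq[OF n, of u c X] by (intro exI[of _ n]) auto
next
  assume "\<exists>n. (\<Sum>i\<le>n. T i \<omega>) < s \<and> s \<le> (\<Sum>i\<le>Suc n. T i \<omega>) \<and> u + c * s < (\<Sum>j=1..Suc n. X j \<omega>)"
  then obtain n where n: "(\<Sum>i\<le>n. T i \<omega>) < s" "s \<le> (\<Sum>i\<le>Suc n. T i \<omega>)" "u + c * s < (\<Sum>j=1..Suc n. X j \<omega>)"
    by blast
  have "claim_count T s \<omega> = enat (Suc n)"
  proof (rule claim_count_eqI)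
    show "(\<Sum>i\<le>j. T i \<omega>) < s" if "j < Suc n" for j
      using that n(1) partial_sums_strict_mono[of j n] by (cases "j = n") auto
  qed (rule n(2))
  from surplus_eq[OF this, of u c X] n(3) show "surplus u c T X s \<omega> < 0"
    by simp
qed

abbreviation (input) "steps \<equiv> \<lambda>i. (X (Suc i) \<omega>, T (Suc i) \<omega>)"

lemma claim_ruins_steps:
  "claim_ruins c (u + c * T 0 \<omega>) steps n \<longleftrightarrow> u + c * (\<Sum>i\<le>n. T i \<omega>) < (\<Sum>j=1..Suc n. X j \<omega>)"
proof -
  have "(\<Sum>i\<le>n. T i \<omega>) = T 0 \<omega> + (\<Sum>i<n. T (Suc i) \<omega>)"
    by (rule sum.atMost_shift)
  moreover have "(\<Sum>j=1..Suc n. X j \<omega>) = (\<Sum>i\<le>n. X (Suc i) \<omega>)"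
    by (simp only: One_nat_def sum.shift_bounds_cl_Suc_ivl atLeast0AtMost)
  ultimately show ?thesis
    by (simp add: claim_ruins_def algebra_simps del: sum.cl_ivl_Suc)
qed

text \<open>
  A claim made at time \<open>t\<close> is not yet counted at \<open>t\<close>, so the surplus is still nonnegative at the
  time of the ruinous claim and becomes negative right after it: the infimum is not attained.
\<close>

lemma ruin_time_eq_first_ruin:
  assumes "first_ruin c (u + c * T 0 \<omega>) steps n"
  shows "ruin_time u c T X \<omega> = ereal (\<Sum>i\<le>n. T i \<omega>)"
proof (rule antisym)
  let ?S = "\<lambda>n. \<Sum>i\<le>n. T i \<omega>"
  have ruin: "u + c * ?S n < (\<Sum>j=1..Suc n. X j \<omega>)"
    and none: "\<And>k. k < n \<Longrightarrow> \<not> u + c * ?S k < (\<Sum>j=1..Suc k. X j \<omega>)"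
    using assms unfolding first_ruin_def claim_ruins_steps by auto
  have S_pos: "0 < ?S k" for k
    by (intro sum_pos) (auto simp: gaps)
  show "ereal (?S n) \<le> ruin_time u c T X \<omega>"
    unfolding ruin_time_def
  proof (intro INF_greatest)
    fix s assume "s \<in> {t. 0 < t \<and> surplus u c T X t \<omega> < 0}"
    then obtain k where k: "?S k < s" "u + c * s < (\<Sum>j=1..Suc k. X j \<omega>)"
      by (auto simp only: negative_surplus_iff mem_Collect_eq)
    have "c * ?S k \<le> c * s"
      using k(1) c_pos by simp
    with k(2) have "u + c * ?S k < (\<Sum>j=1..Suc k. X j \<omega>)"
      by linarith
    with none have "\<not> k < n" by blast
    then have "?S n \<le> ?S k"
      using partial_sums_strict_mono[of n k] by (cases "n = k") auto
    with k(1) show "ereal (?S n) \<le> ereal s" by simp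
  qed
  show "ruin_time u c T X \<omega> \<le> ereal (?S n)"
  proof (rule ccontr)
    assume "\<not> ruin_time u c T X \<omega> \<le> ereal (?S n)"
    then obtain y where y: "ereal (?S n) < ereal y" "ereal y < ruin_time u c T X \<omega>"
      using ereal_dense2[of "ereal (?S n)" "ruin_time u c T X \<omega>"] by (auto simp: not_le)
    \<comment> \<open>Without further claims, the surplus would be back at \<open>0\<close> at time \<open>r\<close>, and negative between the claim and \<open>r\<close>.\<close>
    define r where "r = ((\<Sum>j=1..Suc n. X j \<omega>) - u) / c"
    have "?S n < r"
      using ruin c_pos unfolding r_def by (simp add: pos_less_divide_eq algebra_simps del: sum.cl_ivl_Suc sum.atMost_Suc)
    then obtain r' where r': "?S n < r'" "r' < r"
      using dense by blast
    define s where "s = min y (min r' (?S (Suc n)))"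
    have s: "?S n < s" "s \<le> y" "s < r" "s \<le> ?S (Suc n)"
      unfolding s_def using y(1) r' partial_sums_strict_mono[of n "Suc n"] by auto
    have "c * s < c * r" using s(3) c_pos by simp
    also have "c * r = (\<Sum>j=1..Suc n. X j \<omega>) - u" using c_pos by (simp add: r_def)
    finally have "surplus u c T X s \<omega> < 0"
      using s S_pos[of n] by (subst negative_surplus_iff) (auto intro!: exI[of _ n] simp del: sum.cl_ivl_Suc sum.atMost_Suc)
    moreover have "0 < s" using s(1) S_pos[of n] by simp
    ultimately have "ruin_time u c T X \<omega> \<le> ereal s"
      unfolding ruin_time_def by (intro INF_lower) auto
    with s(2) y(2) show False
      by (meson ereal_less_eq(3) leD order_trans)
  qed
qed

lemma ruin_time_le_iff:
  "ruin_time u c T X \<omega> \<le> ereal s \<longleftrightarrow>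
    (\<exists>n. first_ruin c (u + c * T 0 \<omega>) steps n \<and> (\<Sum>i\<le>n. T i \<omega>) \<le> s)"
proof (cases "\<exists>n. claim_ruins c (u + c * T 0 \<omega>) steps n")
  case True
  then have n: "first_ruin c (u + c * T 0 \<omega>) steps (LEAST n. claim_ruins c (u + c * T 0 \<omega>) steps n)"
    unfolding first_ruin_def by (auto intro: LeastI_ex dest: not_less_Least)
  show ?thesis
  proof
    assume "ruin_time u c T X \<omega> \<le> ereal s"
    with n ruin_time_eq_first_ruin[OF n]
    show "\<exists>n. first_ruin c (u + c * T 0 \<omega>) steps n \<and> (\<Sum>i\<le>n. T i \<omega>) \<le> s"
      by auto
  next
    assume "\<exists>n. first_ruin c (u + c * T 0 \<omega>) steps n \<and> (\<Sum>i\<le>n. T i \<omega>) \<le> s"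
    then show "ruin_time u c T X \<omega> \<le> ereal s"
      using ruin_time_eq_first_ruin by auto
  qed
next
  case False
  have "surplus u c T X t \<omega> \<ge> 0" if t_pos: "0 < t" for t
  proof (rule ccontr)
    assume "\<not> 0 \<le> surplus u c T X t \<omega>"
    then obtain n where n: "(\<Sum>i\<le>n. T i \<omega>) < t" "u + c * t < (\<Sum>j=1..Suc n. X j \<omega>)"
      unfolding not_le negative_surplus_iff[OF t_pos] by blast
    have "c * (\<Sum>i\<le>n. T i \<omega>) \<le> c * t" using n(1) c_pos by simp
    with n(2) have "u + c * (\<Sum>i\<le>n. T i \<omega>) < (\<Sum>j=1..Suc n. X j \<omega>)" by linarith
    with False show False unfolding claim_ruins_steps by blast
  qed
  then have "{t. 0 < t \<and> surplus u c T X t \<omega> < 0} = {}"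
    by (force simp: not_less[symmetric])
  then have "ruin_time u c T X \<omega> = \<infinity>"
    by (simp only: ruin_time_def image_empty Inf_empty top_ereal_def)
  then show ?thesis
    using False by (simp add: first_ruin_def)
qed

end

section \<open>Joint law of the gaps and the claims\<close>

context exponential_claims
begin

text \<open>
  The contribution of ruin at claim \<open>n\<close> (counted from \<open>0\<close>) to the density of the ruin time, when
  \<open>h\<close> is the density of the time of claim \<open>0\<close>.
\<close>

definition ruin_density :: "real \<Rightarrow> (real \<Rightarrow> ennreal) \<Rightarrow> nat \<Rightarrow> real \<Rightarrow> ennreal" where
  "ruin_density u h n t = ennreal (exp (- lam * (u + c * t))) * (case n of 0 \<Rightarrow> h t | Suc k \<Rightarrow>
     ennreal (lam ^ n * (u + c * t) ^ k / fact n) *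
     (ennreal u * conv (conv_power g n) h t + ennreal c * conv (conv_power g n) (\<lambda>s. ennreal s * h s) t))"

lemma measurable_ruin_density:
  assumes h: "causal h"
  shows "ruin_density u h n \<in> borel_measurable borel"
proof -
  note [measurable] = causal_measurable[OF h]
    causal_measurable[OF causal_conv[OF causal_conv_power[OF causal_g] h]]
    causal_measurable[OF causal_conv[OF causal_conv_power[OF causal_g] causal_times_id[OF h]]]
  show ?thesis
    unfolding ruin_density_def[abs_def] by (cases n) (simp_all del: conv_power.simps fact_Suc)
qed

lemma sets_first_ruin_event:
  "{w \<in> space (density lborel h \<Otimes>\<^sub>M path_law).
      first_ruin c (u + c * fst w) (snd w) n \<and> fst w + (\<Sum>i<n. snd (snd w i)) \<le> s}
    \<in> sets (density lborel h \<Otimes>\<^sub>M path_law)"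
proof -
  let ?P = "density lborel h \<Otimes>\<^sub>M path_law"
  have [measurable]: "(\<lambda>w. snd w i) \<in> ?P \<rightarrow>\<^sub>M borel \<Otimes>\<^sub>M borel" for i
    by measurable
  have [measurable]: "snd \<in> ?P \<rightarrow>\<^sub>M (\<Pi>\<^sub>M i\<in>UNIV. borel \<Otimes>\<^sub>M borel)"
    using measurable_snd[of "density lborel h" path_law]
    by (simp cong: measurable_cong_sets add: sets_path_law)
  have [measurable]: "Measurable.pred ?P (\<lambda>w. first_ruin c (u + c * fst w) (snd w) n)"
    by (rule measurable_first_ruin) measurable
  show ?thesis by measurable
qed

text \<open>
  If claim \<open>0\<close> comes at time \<open>t\<close>, the surplus just before it is \<open>u + c * t\<close>. For \<open>n > 0\<close> this is
  the only factor of the kernel that depends on \<open>t\<close> when the time of the ruinous claim is held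
  fixed, and it splits the integral over \<open>t\<close> into two convolutions.
\<close>

lemma emeasure_first_ruin:
  assumes h: "causal h" and "0 \<le> u"
  shows "emeasure (density lborel h \<Otimes>\<^sub>M path_law)
      {w \<in> space (density lborel h \<Otimes>\<^sub>M path_law).
        first_ruin c (u + c * fst w) (snd w) n \<and> fst w + (\<Sum>i<n. snd (snd w i)) \<le> s} =
    (\<integral>\<^sup>+t\<in>{0<..s}. ruin_density u h n t \<partial>lborel)"
proof -
  note [measurable] = causal_measurable[OF h]
  have pos: "0 \<le> c" "0 \<le> lam" using c_pos lam_pos by auto
  interpret path: prob_space path_law
    using prob_step_law by (intro prob_space_PiM)
  let ?P = "density lborel h \<Otimes>\<^sub>M path_law"
  let ?A = "{w \<in> space ?P. first_ruin c (u + c * fst w) (snd w) n \<and> fst w + (\<Sum>i<n. snd (snd w i)) \<le> s}"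
  have "?A \<in> sets ?P" by (rule sets_first_ruin_event)
  then have "emeasure ?P ?A = (\<integral>\<^sup>+w. indicator ?A w \<partial>?P)"
    by simp
  also have "\<dots> = (\<integral>\<^sup>+t. \<integral>\<^sup>+z. indicator ?A (t, z) \<partial>path_law \<partial>density lborel h)"
    using \<open>?A \<in> sets ?P\<close> by (subst path.nn_integral_fst) auto
  also have "\<dots> = (\<integral>\<^sup>+t. h t * (\<integral>\<^sup>+z. indicator ?A (t, z) \<partial>path_law) \<partial>lborel)"
  proof (rule nn_integral_density)
    have "(\<lambda>t. \<integral>\<^sup>+z. indicator ?A (t, z) \<partial>path_law) \<in> borel_measurable (density lborel h)"
      using \<open>?A \<in> sets ?P\<close> by (intro path.borel_measurable_nn_integral_fst) simp
    then show "(\<lambda>t. \<integral>\<^sup>+z. indicator ?A (t, z) \<partial>path_law) \<in> borel_measurable lborel"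
      by simp
  qed simp
  also have "\<dots> = (\<integral>\<^sup>+t. h t * ruin_functional n (u + c * t) (\<lambda>r. indicator {..s} (t + r)) \<partial>lborel)"
    unfolding ruin_functional_def
    by (intro nn_integral_cong arg_cong2[where f="(*)"] refl) (auto simp: indicator_def space_pair_measure)
  also have "\<dots> = (\<integral>\<^sup>+t\<in>{0<..s}. ruin_density u h n t \<partial>lborel)"
  proof (cases n)
    case 0
    show ?thesis
    proof (rule nn_integral_cong)
      fix t
      show "h t * ruin_functional n (u + c * t) (\<lambda>r. indicator {..s} (t + r)) =
          ruin_density u h n t * indicator {0<..s} t"
        using \<open>0 \<le> u\<close> pos causal_zero[OF h, of t] unfolding 0
        by (cases "0 < t") (auto simp: ruin_functional_0 ruin_density_def indicator_def mult.commute)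
    qed
  next
    case (Suc k)
    define p where "p = conv_power g n"
    have p: "causal p" unfolding p_def using causal_g by (rule causal_conv_power)
    note [measurable] = causal_measurable[OF p]
    define W where "W r = ennreal (exp (- lam * (u + c * r))) *
      ennreal (lam ^ n * (u + c * r) ^ k / fact n)" for r
    have [measurable]: "W \<in> borel_measurable borel"
      unfolding W_def by (simp del: fact_Suc)
    let ?mh = "\<lambda>s. ennreal s * h s"
    have "(\<integral>\<^sup>+t. h t * ruin_functional n (u + c * t) (\<lambda>r. indicator {..s} (t + r)) \<partial>lborel) =
        (\<integral>\<^sup>+t. \<integral>\<^sup>+r. W r * indicator {0<..s} r * (ennreal u * (p (r - t) * h t) + ennreal c * (p (r - t) * ?mh t))
          \<partial>lborel \<partial>lborel)"
    proof (rule nn_integral_cong)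
      fix t
      show "h t * ruin_functional n (u + c * t) (\<lambda>r. indicator {..s} (t + r)) =
        (\<integral>\<^sup>+r. W r * indicator {0<..s} r * (ennreal u * (p (r - t) * h t) + ennreal c * (p (r - t) * ?mh t)) \<partial>lborel)"
      proof (cases "0 < t")
        case t: True
        have "ruin_functional n (u + c * t) (\<lambda>r. indicator {..s} (t + r)) =
          (\<integral>\<^sup>+r. ennreal (ruin_kernel k (u + c * t) r) * (p r * indicator {..s} (t + r)) \<partial>lborel)"
          unfolding Suc p_def using \<open>0 \<le> u\<close> pos t by (intro ruin_functional_formula) auto
        also have "\<dots> = (\<integral>\<^sup>+r. ennreal (ruin_kernel k (u + c * t) (r - t)) * (p (r - t) * indicator {..s} r) \<partial>lborel)"
          by (subst nn_integral_real_affine[where c=1 and t="-t"]) (auto simp: ruin_kernel_def)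
        finally have "h t * ruin_functional n (u + c * t) (\<lambda>r. indicator {..s} (t + r)) =
            (\<integral>\<^sup>+r. h t * (ennreal (ruin_kernel k (u + c * t) (r - t)) * (p (r - t) * indicator {..s} r)) \<partial>lborel)"
          by (simp add: nn_integral_cmult ruin_kernel_def)
        also have "\<dots> = (\<integral>\<^sup>+r. W r * indicator {0<..s} r *
            (ennreal u * (p (r - t) * h t) + ennreal c * (p (r - t) * ?mh t)) \<partial>lborel)"
        proof (rule nn_integral_cong)
          fix r
          show "h t * (ennreal (ruin_kernel k (u + c * t) (r - t)) * (p (r - t) * indicator {..s} r)) =
            W r * indicator {0<..s} r * (ennreal u * (p (r - t) * h t) + ennreal c * (p (r - t) * ?mh t))"
          proof (cases "t < r")
            case r: True
            have "ruin_kernel k (u + c * t) (r - t) =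
                exp (- lam * (u + c * r)) * (lam ^ n * (u + c * r) ^ k / fact n) * (u + c * t)"
              unfolding ruin_kernel_def Suc by (simp add: algebra_simps del: fact_Suc)
            also have "ennreal \<dots> = W r * ennreal (u + c * t)"
            proof -
              have "0 \<le> lam ^ n * (u + c * r) ^ k / fact n" "0 \<le> u + c * t"
                using \<open>0 \<le> u\<close> pos t r by auto
              then show ?thesis
                by (simp only: W_def ennreal_mult mult_nonneg_nonneg exp_ge_zero)
            qed
            finally have "ennreal (ruin_kernel k (u + c * t) (r - t)) = W r * ennreal (u + c * t)" .
            moreover have "ennreal (u + c * t) = ennreal u + ennreal c * ennreal t"
              using \<open>0 \<le> u\<close> pos t by (simp add: ennreal_plus ennreal_mult)
            moreover have "indicator {..s} r = (indicator {0<..s} r :: ennreal)"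
              using t r by (simp add: indicator_def)
            ultimately show ?thesis
              by (simp add: distrib_left distrib_right mult_ac)
          qed (simp add: causal_zero[OF p])
        qed
        finally show ?thesis .
      qed (simp add: causal_zero[OF h])
    qed
    also have "\<dots> = (\<integral>\<^sup>+r. \<integral>\<^sup>+t. W r * indicator {0<..s} r *
        (ennreal u * (p (r - t) * h t) + ennreal c * (p (r - t) * ?mh t)) \<partial>lborel \<partial>lborel)"
      by (rule lborel_pair.Fubini') simp
    also have "\<dots> = (\<integral>\<^sup>+r. W r * indicator {0<..s} r *
        (ennreal u * conv p h r + ennreal c * conv p ?mh r) \<partial>lborel)"
      by (simp add: nn_integral_cmult nn_integral_add conv_causal p h causal_times_id)
    also have "\<dots> = (\<integral>\<^sup>+t\<in>{0<..s}. ruin_density u h n t \<partial>lborel)"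
      by (intro nn_integral_cong) (simp add: ruin_density_def W_def p_def Suc mult_ac del: conv_power.simps fact_Suc)
    finally show ?thesis .
  qed
  finally show ?thesis .
qed

end

lemma (in prob_space) distributed_exponential_of_tail:
  assumes [measurable]: "X \<in> borel_measurable M" and "0 < l"
    and tail: "\<And>x. 0 \<le> x \<Longrightarrow> prob {\<omega> \<in> space M. x < X \<omega>} = exp (- l * x)"
  shows "distributed M lborel X (\<lambda>x. ennreal (exponential_density l x))"
proof (subst exponential_distributed_iff[OF \<open>0 < l\<close>], intro conjI allI impI)
  fix a :: real assume "0 \<le> a"
  have "{\<omega> \<in> space M. X \<omega> \<le> a} = space M - {\<omega> \<in> space M. a < X \<omega>}"
    by auto
  then have "prob {\<omega> \<in> space M. X \<omega> \<le> a} = 1 - prob {\<omega> \<in> space M. a < X \<omega>}"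
    by (simp add: prob_compl)
  with tail[OF \<open>0 \<le> a\<close>] show "\<P>(\<omega> in M. X \<omega> \<le> a) = 1 - exp (- a * l)"
    by (simp add: mult.commute)
qed simp

text \<open>
  The independent family is regrouped: the time of the first claim on one side, the sequence of
  pairs of a claim and the gap following it on the other.
\<close>

lemma (in prob_space) distr_renewal_claims:
  fixes T X :: "nat \<Rightarrow> 'a \<Rightarrow> real"
  assumes indep: "indep_vars (\<lambda>_. borel) (case_sum T X) (UNIV <+> {1..})"
    and T0: "distributed M lborel (T 0) h"
    and T: "\<And>j. 1 \<le> j \<Longrightarrow> distributed M lborel (T j) g"
    and X: "\<And>j. 1 \<le> j \<Longrightarrow> distributed M lborel (X j) e"
  shows "distr M (borel \<Otimes>\<^sub>M (\<Pi>\<^sub>M i\<in>UNIV. borel \<Otimes>\<^sub>M borel)) (\<lambda>\<omega>. (T 0 \<omega>, \<lambda>i. (X (Suc i) \<omega>, T (Suc i) \<omega>))) =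
    density lborel h \<Otimes>\<^sub>M (\<Pi>\<^sub>M i\<in>UNIV. density lborel e \<Otimes>\<^sub>M density lborel g)"
proof -
  let ?Y = "case_sum T X" and ?Z = "\<lambda>i \<omega>. (X (Suc i) \<omega>, T (Suc i) \<omega>)"
  have rv: "?Y i \<in> borel_measurable M" if "i \<in> UNIV <+> {1..}" for i
    using indep that unfolding indep_vars_def by blast
  have rT [measurable]: "T j \<in> borel_measurable M" for j
    using rv[of "Inl j"] by auto
  have rX [measurable]: "X (Suc j) \<in> borel_measurable M" for j
    using rv[of "Inr (Suc j)"] by auto
  have law: "distr M borel V = density lborel v" if "distributed M lborel V v" for V :: "'a \<Rightarrow> real" and v
    using distributed_distr_eq_density[OF that] by (simp cong: distr_cong)
  have pair: "distr M (borel \<Otimes>\<^sub>M borel) (?Z i) = density lborel e \<Otimes>\<^sub>M density lborel g" for i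
  proof -
    have "indep_var borel ((\<lambda>y. y (Inr (Suc i))) \<circ> (\<lambda>\<omega>. restrict (\<lambda>i. ?Y i \<omega>) {Inr (Suc i)}))
        borel ((\<lambda>y. y (Inl (Suc i))) \<circ> (\<lambda>\<omega>. restrict (\<lambda>i. ?Y i \<omega>) {Inl (Suc i)}))"
      by (intro indep_var_compose[OF indep_var_restrict[OF indep]]) auto
    then have "indep_var borel (X (Suc i)) borel (T (Suc i))"
      by (simp add: comp_def)
    then show ?thesis
      by (simp add: indep_var_distribution_eq law[OF X] law[OF T])
  qed
  have "indep_vars (\<lambda>_. borel \<Otimes>\<^sub>M borel) (\<lambda>i \<omega>. (\<lambda>y. (y (Inr (Suc i)), y (Inl (Suc i))))
      (restrict (\<lambda>i. ?Y i \<omega>) {Inl (Suc i), Inr (Suc i)})) UNIV"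
    by (intro indep_vars_compose2[OF indep_vars_restrict[OF indep]]) (auto simp: disjoint_family_on_def)
  then have "indep_vars (\<lambda>_. borel \<Otimes>\<^sub>M borel) ?Z UNIV"
    by simp
  then have Z: "distr M (\<Pi>\<^sub>M i\<in>UNIV. borel \<Otimes>\<^sub>M borel) (\<lambda>\<omega> i. ?Z i \<omega>) =
      (\<Pi>\<^sub>M i\<in>UNIV. density lborel e \<Otimes>\<^sub>M density lborel g)"
    by (subst (asm) indep_vars_iff_distr_eq_PiM') (auto simp: pair restrict_UNIV)
  \<comment> \<open>\<^const>\<open>indep_var\<close> needs both variables to have the same type. The two groups are therefore
    separated as restrictions of the same family and mapped to their final types afterwards.\<close>
  let ?A = "{Inl 0} :: (nat + nat) set" and ?B = "Inl ` {1..} \<union> Inr ` {1..} :: (nat + nat) set"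
  let ?R = "\<lambda>K \<omega>. restrict (\<lambda>i. ?Y i \<omega>) K"
  let ?PA = "\<Pi>\<^sub>M i\<in>?A. borel :: real measure" and ?PB = "\<Pi>\<^sub>M i\<in>?B. borel :: real measure"
  let ?S = "\<Pi>\<^sub>M i\<in>(UNIV::nat set). (borel :: real measure) \<Otimes>\<^sub>M (borel :: real measure)"
  let ?\<phi> = "\<lambda>y :: nat + nat \<Rightarrow> real. y (Inl 0)"
  let ?\<psi> = "\<lambda>y :: nat + nat \<Rightarrow> real. \<lambda>i. (y (Inr (Suc i)), y (Inl (Suc i)))"
  have "indep_var ?PA (?R ?A) ?PB (?R ?B)"
    by (intro indep_var_restrict[OF indep]) auto
  then have RA [measurable]: "?R ?A \<in> M \<rightarrow>\<^sub>M ?PA" and RB [measurable]: "?R ?B \<in> M \<rightarrow>\<^sub>M ?PB"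
    and joint: "distr M ?PA (?R ?A) \<Otimes>\<^sub>M distr M ?PB (?R ?B) = distr M (?PA \<Otimes>\<^sub>M ?PB) (\<lambda>\<omega>. (?R ?A \<omega>, ?R ?B \<omega>))"
    unfolding indep_var_distribution_eq by auto
  have \<phi> [measurable]: "?\<phi> \<in> ?PA \<rightarrow>\<^sub>M borel"
    by (rule measurable_component_singleton) simp
  have [measurable]: "(\<lambda>y. y (Inr (Suc i))) \<in> borel_measurable ?PB" "(\<lambda>y. y (Inl (Suc i))) \<in> borel_measurable ?PB" for i
    by (rule measurable_component_singleton; simp)+
  have \<psi> [measurable]: "?\<psi> \<in> ?PB \<rightarrow>\<^sub>M ?S"
    by (rule measurable_PiM_single') (auto simp: space_pair_measure)
  have \<phi>\<psi>: "(\<lambda>(x, y). (?\<phi> x, ?\<psi> y)) \<in> ?PA \<Otimes>\<^sub>M ?PB \<rightarrow>\<^sub>M borel \<Otimes>\<^sub>M ?S"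
    unfolding case_prod_beta' by (intro measurable_Pair measurable_compose[OF measurable_fst \<phi>]
      measurable_compose[OF measurable_snd \<psi>])
  have Z_measurable: "(\<lambda>\<omega> i. ?Z i \<omega>) \<in> M \<rightarrow>\<^sub>M ?S"
    by (rule measurable_PiM_single') (auto simp: space_pair_measure)
  have law_T0: "distr (distr M ?PA (?R ?A)) borel ?\<phi> = density lborel h"
    by (subst distr_distr[OF \<phi> RA]) (simp add: comp_def law[OF T0])
  have law_Z: "distr (distr M ?PB (?R ?B)) ?S ?\<psi> = (\<Pi>\<^sub>M i\<in>UNIV. density lborel e \<Otimes>\<^sub>M density lborel g)"
    by (subst distr_distr[OF \<psi> RB]) (simp add: comp_def Z)
  have "prob_space (distr M ?S (\<lambda>\<omega> i. ?Z i \<omega>))"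
    using Z_measurable by (rule prob_space_distr)
  then have sigma_finite: "sigma_finite_measure (distr (distr M ?PB (?R ?B)) ?S ?\<psi>)"
    unfolding law_Z Z by (rule prob_space_imp_sigma_finite)
  have "density lborel h \<Otimes>\<^sub>M (\<Pi>\<^sub>M i\<in>UNIV. density lborel e \<Otimes>\<^sub>M density lborel g) =
      distr (distr M ?PA (?R ?A)) borel ?\<phi> \<Otimes>\<^sub>M distr (distr M ?PB (?R ?B)) ?S ?\<psi>"
    by (simp only: law_T0 law_Z)
  also have "\<dots> = distr (distr M ?PA (?R ?A) \<Otimes>\<^sub>M distr M ?PB (?R ?B)) (borel \<Otimes>\<^sub>M ?S) (\<lambda>(x, y). (?\<phi> x, ?\<psi> y))"
    by (rule pair_measure_distr) (use sigma_finite \<phi> \<psi> in simp_all)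
  also have "\<dots> = distr M (borel \<Otimes>\<^sub>M ?S) (\<lambda>\<omega>. (T 0 \<omega>, \<lambda>i. ?Z i \<omega>))"
    unfolding joint by (subst distr_distr[OF \<phi>\<psi> measurable_Pair[OF RA RB]]) (simp add: comp_def)
  finally show ?thesis ..
qed

section \<open>The density of the ruin time\<close>

theorem theorem1:
  fixes M :: "'a measure" and T X :: "nat \<Rightarrow> 'a \<Rightarrow> real"
    and f0 f :: "real \<Rightarrow> real" and u c lam :: real
  assumes "prob_space M"
    and "u \<ge> 0" and "c > 0" and "lam > 0"
    and "prob_space.indep_vars M (\<lambda>_. borel) (case_sum T X) (UNIV <+> {1..})"
    and "\<And>j. AE \<omega> in M. 0 < T j \<omega>"
    and "\<And>x. x > 0 \<Longrightarrow> f0 x \<ge> 0" and "\<And>x. x > 0 \<Longrightarrow> f x \<ge> 0"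
    and "distributed M lborel (T 0) (\<lambda>x. ennreal (f0 x) * indicator {0<..} x)"
    and "\<And>j. j \<ge> 1 \<Longrightarrow> distributed M lborel (T j) (\<lambda>x. ennreal (f x) * indicator {0<..} x)"
    and "\<And>j x. j \<ge> 1 \<Longrightarrow> x \<ge> 0 \<Longrightarrow> measure M {\<omega> \<in> space M. X j \<omega> > x} = exp (- lam * x)"
  shows "has_defective_density M (ruin_time u c T X)
    (\<lambda>t. ennreal (exp (- lam * (u + c * t))) *
       (ennreal (f0 t) +
        (\<Sum>k. let n = Suc k in
           ennreal (lam ^ n * (u + c * t) ^ (n - 1) / fact n) *
           (ennreal u * conv (conv_power (\<lambda>s. ennreal (f s)) n) (\<lambda>s. ennreal (f0 s)) t +
            ennreal c * conv (conv_power (\<lambda>s. ennreal (f s)) n) (\<lambda>s. ennreal (s * f0 s)) t))))"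
proof -
  interpret prob_space M by fact
  define h where "h x = ennreal (f0 x) * indicator {0<..} x" for x
  define g where "g x = ennreal (f x) * indicator {0<..} x" for x
  have T0: "distributed M lborel (T 0) h" and T: "\<And>j. 1 \<le> j \<Longrightarrow> distributed M lborel (T j) g"
    unfolding h_def g_def by fact+
  have indep: "indep_vars (\<lambda>_. borel) (case_sum T X) (UNIV <+> {1..})" by fact
  have rv: "case_sum T X i \<in> borel_measurable M" if "i \<in> UNIV <+> {1..}" for i
    using indep that unfolding indep_vars_def by blast
  have rT [measurable]: "T j \<in> borel_measurable M" for j
    using rv[of "Inl j"] by auto
  have rX: "X j \<in> borel_measurable M" if "1 \<le> j" for j
    using rv[of "Inr j"] that by auto
  have rXS [measurable]: "X (Suc j) \<in> borel_measurable M" for j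
    by (rule rX) simp
  have X: "distributed M lborel (X j) (\<lambda>x. ennreal (exponential_density lam x))" if "1 \<le> j" for j
    using assms(11)[OF that] \<open>0 < lam\<close> rX[OF that] by (intro distributed_exponential_of_tail) auto
  have causal_h: "causal h"
    using distributed_borel_measurable[OF T0] by (auto simp: causal_def h_def)
  have causal_g: "causal g"
    using distributed_borel_measurable[OF T[of 1]] by (auto simp: causal_def g_def)
  have "prob_space (density lborel g)"
    using prob_space_distr[of "T 1" lborel] distributed_distr_eq_density[OF T[of 1]] by simp
  then interpret exponential_claims c lam g
    using \<open>c > 0\<close> \<open>lam > 0\<close> causal_g
    by (intro exponential_claims.intro)

  let ?p = "\<lambda>t. ennreal (exp (- lam * (u + c * t))) *
       (ennreal (f0 t) +
        (\<Sum>k. let n = Suc k in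
           ennreal (lam ^ n * (u + c * t) ^ (n - 1) / fact n) *
           (ennreal u * conv (conv_power (\<lambda>s. ennreal (f s)) n) (\<lambda>s. ennreal (f0 s)) t +
            ennreal c * conv (conv_power (\<lambda>s. ennreal (f s)) n) (\<lambda>s. ennreal (s * f0 s)) t)))"
  \<comment> \<open>Ruin at the first claim contributes the summand with \<open>f0\<close> outside the series.\<close>
  have density_eq: "?p t = (\<Sum>n. ruin_density u h n t)" if "0 < t" for t
  proof -
    have conv_h: "conv (conv_power (\<lambda>s. ennreal (f s)) n) (\<lambda>s. ennreal (f0 s)) t = conv (conv_power g n) h t" for n
      by (intro conv_cong conv_power_cong) (auto simp: g_def h_def)
    have conv_mh: "conv (conv_power (\<lambda>s. ennreal (f s)) n) (\<lambda>s. ennreal (s * f0 s)) t =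
        conv (conv_power g n) (\<lambda>s. ennreal s * h s) t" for n
      using assms(7) by (intro conv_cong conv_power_cong) (auto simp: g_def h_def ennreal_mult)
    have "(\<Sum>n. ruin_density u h n t) = (\<Sum>k. ruin_density u h (Suc k) t) + ruin_density u h 0 t"
      using suminf_offset[of "\<lambda>n. ruin_density u h n t" 1] by simp
    also have "ruin_density u h 0 t = ennreal (exp (- lam * (u + c * t))) * ennreal (f0 t)"
      using that by (simp add: ruin_density_def h_def)
    also have "(\<Sum>k. ruin_density u h (Suc k) t) + \<dots> = ?p t"
      unfolding conv_h conv_mh
      by (simp only: ruin_density_def nat.case ennreal_suminf_cmult Let_def diff_Suc_1 distrib_left[symmetric]
        add.commute)
    finally show ?thesis ..
  qed
  note [measurable] = measurable_ruin_density[OF causal_h]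

  have prob_le: "emeasure M {\<omega> \<in> space M. ruin_time u c T X \<omega> \<le> ereal s} =
    (\<integral>\<^sup>+r\<in>{0<..s}. ?p r \<partial>lborel)" for s
  proof -
    let ?Z = "\<lambda>\<omega> i. (X (Suc i) \<omega>, T (Suc i) \<omega>)"
    let ?P = "density lborel h \<Otimes>\<^sub>M path_law"
    let ?A = "\<lambda>n. {w \<in> space ?P. first_ruin c (u + c * fst w) (snd w) n \<and> fst w + (\<Sum>i<n. snd (snd w i)) \<le> s}"
    let ?B = "\<lambda>n. {\<omega> \<in> space M. first_ruin c (u + c * T 0 \<omega>) (?Z \<omega>) n \<and> (\<Sum>i\<le>n. T i \<omega>) \<le> s}"
    have Z [measurable]: "?Z \<in> M \<rightarrow>\<^sub>M (\<Pi>\<^sub>M i\<in>UNIV. borel \<Otimes>\<^sub>M borel)"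
      by (rule measurable_PiM_single') (auto simp: space_pair_measure)
    have joint [measurable]: "(\<lambda>\<omega>. (T 0 \<omega>, ?Z \<omega>)) \<in> M \<rightarrow>\<^sub>M borel \<Otimes>\<^sub>M (\<Pi>\<^sub>M i\<in>UNIV. borel \<Otimes>\<^sub>M borel)"
      by measurable
    have law: "distr M (borel \<Otimes>\<^sub>M (\<Pi>\<^sub>M i\<in>UNIV. borel \<Otimes>\<^sub>M borel)) (\<lambda>\<omega>. (T 0 \<omega>, ?Z \<omega>)) = ?P"
      by (rule distr_renewal_claims[OF indep T0 T X])
    have B [measurable]: "?B n \<in> sets M" for n
      by measurable
    have "disjoint_family ?B"
      by (auto simp: disjoint_family_on_def first_ruin_def) (metis linorder_neqE_nat)
    have "?A n \<in> sets (distr M (borel \<Otimes>\<^sub>M (\<Pi>\<^sub>M i\<in>UNIV. borel \<Otimes>\<^sub>M borel)) (\<lambda>\<omega>. (T 0 \<omega>, ?Z \<omega>)))" for n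
      unfolding law by (rule sets_first_ruin_event)
    then have A: "?A n \<in> sets (borel \<Otimes>\<^sub>M (\<Pi>\<^sub>M i\<in>UNIV. borel \<Otimes>\<^sub>M borel))" for n
      by simp
    have in_space: "(T 0 \<omega>, ?Z \<omega>) \<in> space ?P" if "\<omega> \<in> space M" for \<omega>
      unfolding law[symmetric] using measurable_space[OF joint that] by simp
    have "AE \<omega> in M. \<forall>j. 0 < T j \<omega>"
      using assms(6) by (simp add: AE_all_countable)
    then have "AE \<omega> in M. ruin_time u c T X \<omega> \<le> ereal s \<longleftrightarrow> \<omega> \<in> (\<Union>n. ?B n)"
    proof (rule AE_mp, intro AE_I2 impI)
      fix \<omega> assume "\<omega> \<in> space M" "\<forall>j. 0 < T j \<omega>"
      then show "ruin_time u c T X \<omega> \<le> ereal s \<longleftrightarrow> \<omega> \<in> (\<Union>n. ?B n)"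
        using \<open>0 \<le> u\<close> \<open>0 < c\<close> by (subst ruin_time_le_iff) auto
    qed
    then have "emeasure M {\<omega> \<in> space M. ruin_time u c T X \<omega> \<le> ereal s} = emeasure M (\<Union>n. ?B n)"
      using rT rX \<open>0 \<le> u\<close> \<open>0 < c\<close>
      by (intro emeasure_eq_AE) (auto intro!: borel_measurable_le measurable_ruin_time)
    also have "\<dots> = (\<Sum>n. emeasure M (?B n))"
      using \<open>disjoint_family ?B\<close> by (intro suminf_emeasure[symmetric]) auto
    also have "\<dots> = (\<Sum>n. emeasure ?P (?A n))"
    proof (rule suminf_cong)
      fix n
      have "emeasure ?P (?A n) = emeasure M ((\<lambda>\<omega>. (T 0 \<omega>, ?Z \<omega>)) -` ?A n \<inter> space M)"
        by (subst law[symmetric]) (rule emeasure_distr[OF joint A])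
      also have "(\<lambda>\<omega>. (T 0 \<omega>, ?Z \<omega>)) -` ?A n \<inter> space M = ?B n"
        using in_space by (auto simp: sum.atMost_shift)
      finally show "emeasure M (?B n) = emeasure ?P (?A n)" ..
    qed
    also have "\<dots> = (\<Sum>n. \<integral>\<^sup>+t\<in>{0<..s}. ruin_density u h n t \<partial>lborel)"
      using emeasure_first_ruin[OF causal_h \<open>0 \<le> u\<close>] by simp
    also have "\<dots> = (\<integral>\<^sup>+t. (\<Sum>n. ruin_density u h n t * indicator {0<..s} t) \<partial>lborel)"
      by (rule nn_integral_suminf[symmetric]) simp
    also have "\<dots> = (\<integral>\<^sup>+r\<in>{0<..s}. ?p r \<partial>lborel)"
    proof (rule nn_integral_cong)
      fix r
      have sum: "(\<Sum>n. ruin_density u h n r * indicator {0<..s} r) =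
          (\<Sum>n. ruin_density u h n r) * indicator {0<..s} r"
        by (rule ennreal_suminf_multc)
      show "(\<Sum>n. ruin_density u h n r * indicator {0<..s} r) = ?p r * indicator {0<..s} r"
      proof (cases "0 < r")
        case True
        show ?thesis
          unfolding sum density_eq[OF True] ..
      qed simp
    qed
    finally show ?thesis .
  qed
  show ?thesis
    unfolding has_defective_density_def
  proof (intro conjI allI impI)
    show "ruin_time u c T X \<in> borel_measurable M"
      using rT rX \<open>0 \<le> u\<close> \<open>0 < c\<close> by (intro measurable_ruin_time) auto
    have "(\<lambda>t. \<Sum>n. ruin_density u h n t) \<in> borel_measurable (restrict_space lborel {0<..})"
      by (intro measurable_restrict_space1) simp
    moreover have "?p \<in> borel_measurable (restrict_space lborel {0<..}) \<longleftrightarrow>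
        (\<lambda>t. \<Sum>n. ruin_density u h n t) \<in> borel_measurable (restrict_space lborel {0<..})"
      by (rule measurable_cong) (rule density_eq, simp add: space_restrict_space)
    ultimately show "?p \<in> borel_measurable (restrict_space lborel {0<..})"
      by blast
  qed (rule prob_le)
qed

end
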